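(* Let $0<\kappa_1<\kappa_2$, and consider, with parameters $(\mu,\eta)\in\mathbb{R}^2$, the piecewise-smooth system $(\dot x,\dot y)^T=f_1(x,y)$ for $y<x+\eta$, $(\dot x,\dot y)^T=f_2(x,y)$ for $y>x+\eta$, where $f_i(x,y)=\binom{1-(1+\kappa_i)x}{\mu-\kappa_i y}$, with switching manifold $\Sigma=\{y=x+\eta\}$. It has the following codimension-one bifurcations. 1. Boundary equilibrium bifurcations of $p_1$ and $p_2$ occur, respectively, along the straight lines $$\mathrm{BE}_1:\ (\mu,\eta)=\left(\mu,\ \frac{\mu}{\kappa_1}-\frac{1}{1+\kappa_1}\right),\qquad \mathrm{BE}_2:\ (\mu,\eta)=\left(\mu,\ \frac{\mu}{\kappa_2}-\frac{1}{1+\kappa_2}\right).$$ At $\mathrm{BE}_i$ the equilibrium $p_i$ collides with the tangency point $F_i$, changing its visibility. The tangency point $F_1$ is visible in regions I, IV and VIII. Similarly, the tangency point $F_2$ is visible in regions III, VI, VII and VIII. The pseudo-equilibrium $q^+$ is admissible in regions II, V and VII. Similarly, the pseudo-equilibrium $q^-$ is admissible in regions VII and VIII. 2. Fold-fold bifurcations occur along the horizontal line $$\mathrm{FF}:\ (\mu,\eta)=(\mu,0).$$ At $\mathrm{FF}$ the tangency points $F_1$ and $F_2$ coincide at a singular tangency point $F^*$ and switch places on the sliding segment boundary, resulting in the sliding segment changing between being attracting and repelling. 3. A pseudo-saddle-node bifurcation occurs along the curve segment $$\mathrm{PS}:\ (\mu,\eta)=\left(\mu,\ -(\mu+1)+2\sqrt{\mu}\right),\qquad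 \frac{\kappa_1^2}{(\kappa_1+1)^2}<\mu<\frac{\kappa_2^2}{(\kappa_2+1)^2}.$$ Along $\mathrm{PS}$ the pseudo-equilibria $q^-$ and $q^+$ form a saddle-node at $$q^*=(1-\sqrt{\mu})\binom{1}{1}+\binom{0}{\eta}$$ on the repelling sliding segment $\Sigma_s^r$.
   Context: Notation. $R_1=\{y<x+\eta\}$, $R_2=\{y>x+\eta\}$, $\mathbf{n}=\binom{-1}{1}$. The equilibrium of $f_i$ is $p_i=\left(\frac{1}{1+\kappa_i},\frac{\mu}{\kappa_i}\right)$; it is admissible if $p_i\in R_i$. The sliding segment $\Sigma_s\subset\Sigma$ is the set of points where $f_1\cdot\mathbf{n}$ and $f_2\cdot\mathbf{n}$ are non-zero with opposite signs; it is attracting ($\Sigma_s^a$) if both vector fields point towards $\Sigma$ and repelling ($\Sigma_s^r$) if both point away. The tangency point $F_i$ is the point of $\Sigma$ where $f_i\cdot\mathbf{n}=0$, namely $F_i=\binom{1-\mu+\eta\kappa_i}{1-\mu+(1+\kappa_i)\eta}$; it is quadratic if $f_i\cdot\nabla(f_i\cdot\mathbf{n})\ne0$ there, and a quadratic tangency is visible if the orbit of $f_i$ through $F_i$ lies locally in $R_i$ (apart from $F_i$), and invisible otherwise. On $\Sigma_s$ the sliding vector field is Filippov's convex combination $f_s=(1-\lambda)f_1+\lambda f_2$, $\lambda\in[0,1]$, that is tangent to $\Sigma$. Pseudo-equilibria are the zeros of the resulting (extended) expression for $f_s$ on $\Sigma$: $$q^{\pm}=\tfrac12\left(1-\mu-\eta\pm\sqrt{(\eta+\mu+1)^2-4\mu}\right)\binom11+\binom0\eta,$$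 and are admissible if they lie on $\Sigma_s$. Bifurcations. A boundary equilibrium bifurcation of $p_i$ occurs when $p_i\in\Sigma$. A fold-fold bifurcation occurs when the tangency points $F_1$ and $F_2$ coincide. A pseudo-saddle-node bifurcation is a saddle-node bifurcation of pseudo-equilibria of $f_s$ on $\Sigma_s$. Regions. Write $b_i=\frac{\mu}{\kappa_i}-\frac{1}{1+\kappa_i}$. The curves $\mathrm{BE}_1,\mathrm{BE}_2,\mathrm{FF},\mathrm{PS}$ divide the $(\mu,\eta)$-plane into the following open regions: I: $\eta>0$, $\eta>b_1$ (and $\eta>b_2$), so only $p_1$ is admissible; II: $\eta>0$, $b_2<\eta<b_1$, so neither $p_1$ nor $p_2$ is admissible; III: $\eta>0$, $\eta<b_2$ (and $\eta<b_1$), so only $p_2$ is admissible; IV: $\eta<0$, $\eta>b_1$, $\eta>b_2$, so only $p_1$ is admissible; V: $\eta<0$, $b_2<\eta<b_1$, so neither $p_1$ nor $p_2$ is admissible; VII: $\frac{\kappa_1^2}{(\kappa_1+1)^2}<\mu<\frac{\kappa_2^2}{(\kappa_2+1)^2}$ and $-(\mu+1)+2\sqrt{\mu}<\eta<\min(b_1,b_2)$, the region bounded by $\mathrm{PS}$, $\mathrm{BE}_1$ and $\mathrm{BE}_2$; VI: the set of $(\mu,\eta)$ with $\eta<0$, $\eta<b_1$, $\eta<b_2$ that are not in the closure of region VII (in both VI and VII only $p_2$ is admissible); VIII: $\eta<0$, $b_1<\eta<b_2$, so both $p_1$ and $p_2$ are admissible. *)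

theory Defs
  imports "HOL-Analysis.Analysis"
begin

section \<open>The piecewise-smooth system\<close>

definition vf :: "real \<Rightarrow> real \<Rightarrow> real \<times> real \<Rightarrow> real \<times> real" where
  "vf \<kappa> \<mu> z = (1 - (1 + \<kappa>) * fst z, \<mu> - \<kappa> * snd z)"

definition switching_manifold :: "real \<Rightarrow> (real \<times> real) set" where
  "switching_manifold \<eta> = {(x, y). y = x + \<eta>}"

definition R1 :: "real \<Rightarrow> (real \<times> real) set" where
  "R1 \<eta> = {(x, y). y < x + \<eta>}"

definition R2 :: "real \<Rightarrow> (real \<times> real) set" where
  "R2 \<eta> = {(x, y). y > x + \<eta>}"

text \<open>The normal vector points from \<open>R1\<close> into \<open>R2\<close>.\<close>

definition nvec :: "real \<times> real" where
  "nvec = (-1, 1)"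

definition equilibrium :: "real \<Rightarrow> real \<Rightarrow> real \<times> real" where
  "equilibrium \<kappa> \<mu> = (1 / (1 + \<kappa>), \<mu> / \<kappa>)"

lemma equilibrium_iff:
  assumes "\<kappa> > 0"
  shows "vf \<kappa> \<mu> z = 0 \<longleftrightarrow> z = equilibrium \<kappa> \<mu>"
  using assms
  by (cases z) (auto simp: vf_def equilibrium_def zero_prod_def field_simps)


section \<open>Tangency points\<close>

definition tangency_point :: "real \<Rightarrow> real \<Rightarrow> real \<Rightarrow> real \<times> real" where
  "tangency_point \<kappa> \<mu> \<eta> = (1 - \<mu> + \<eta> * \<kappa>, 1 - \<mu> + (1 + \<kappa>) * \<eta>)"

lemma tangency_point_iff:
  "z \<in> switching_manifold \<eta> \<and> vf \<kappa> \<mu> z \<bullet> nvec = 0 \<longleftrightarrow> z = tangency_point \<kappa> \<mu> \<eta>"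
proof -
  obtain x y where z: "z = (x, y)"
    by (cases z)
  have "vf \<kappa> \<mu> (x, x + \<eta>) \<bullet> nvec = x - (1 - \<mu> + \<eta> * \<kappa>)"
    by (simp add: vf_def nvec_def algebra_simps)
  moreover have "z = tangency_point \<kappa> \<mu> \<eta> \<longleftrightarrow> y = x + \<eta> \<and> x = 1 - \<mu> + \<eta> * \<kappa>"
    by (auto simp: z tangency_point_def algebra_simps)
  ultimately show ?thesis
    by (auto simp: z switching_manifold_def)
qed

definition quadratic_tangency ::
  "real \<Rightarrow> (real \<times> real \<Rightarrow> real \<times> real) \<Rightarrow> real \<times> real \<Rightarrow> bool" where
  "quadratic_tangency \<eta> g z \<longleftrightarrow>
     z \<in> switching_manifold \<eta> \<and> g z \<bullet> nvec = 0 \<and>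
     (\<exists>D. GDERIV (\<lambda>w. g w \<bullet> nvec) z :> D \<and> g z \<bullet> D \<noteq> 0)"

text \<open>The set \<open>R\<close> is the half-plane in which the vector field \<open>g\<close> acts. The vector fields used
  below are affine, so that the orbit through a point is defined for all times and is unique.\<close>

definition visible_tangency ::
  "real \<Rightarrow> (real \<times> real \<Rightarrow> real \<times> real) \<Rightarrow> (real \<times> real) set \<Rightarrow> real \<times> real \<Rightarrow> bool" where
  "visible_tangency \<eta> g R z \<longleftrightarrow>
     quadratic_tangency \<eta> g z \<and>
     (\<exists>\<phi> :: real \<Rightarrow> real \<times> real.
        \<phi> 0 = z \<and>
        (\<forall>t. (\<phi> has_vector_derivative g (\<phi> t)) (at t)) \<and>
        (\<exists>\<epsilon>>0. \<forall>t. 0 < \<bar>t\<bar> \<and> \<bar>t\<bar> < \<epsilon> \<longrightarrow> \<phi> t \<in> R))"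

definition invisible_tangency ::
  "real \<Rightarrow> (real \<times> real \<Rightarrow> real \<times> real) \<Rightarrow> (real \<times> real) set \<Rightarrow> real \<times> real \<Rightarrow> bool" where
  "invisible_tangency \<eta> g R z \<longleftrightarrow> quadratic_tangency \<eta> g z \<and> \<not> visible_tangency \<eta> g R z"

definition F1_visible :: "real \<Rightarrow> real \<Rightarrow> real \<Rightarrow> bool" where
  "F1_visible \<kappa>\<^sub>1 \<mu> \<eta> \<longleftrightarrow>
     visible_tangency \<eta> (vf \<kappa>\<^sub>1 \<mu>) (R1 \<eta>) (tangency_point \<kappa>\<^sub>1 \<mu> \<eta>)"

definition F1_invisible :: "real \<Rightarrow> real \<Rightarrow> real \<Rightarrow> bool" where
  "F1_invisible \<kappa>\<^sub>1 \<mu> \<eta> \<longleftrightarrow>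
     invisible_tangency \<eta> (vf \<kappa>\<^sub>1 \<mu>) (R1 \<eta>) (tangency_point \<kappa>\<^sub>1 \<mu> \<eta>)"

definition F2_visible :: "real \<Rightarrow> real \<Rightarrow> real \<Rightarrow> bool" where
  "F2_visible \<kappa>\<^sub>2 \<mu> \<eta> \<longleftrightarrow>
     visible_tangency \<eta> (vf \<kappa>\<^sub>2 \<mu>) (R2 \<eta>) (tangency_point \<kappa>\<^sub>2 \<mu> \<eta>)"

definition F2_invisible :: "real \<Rightarrow> real \<Rightarrow> real \<Rightarrow> bool" where
  "F2_invisible \<kappa>\<^sub>2 \<mu> \<eta> \<longleftrightarrow>
     invisible_tangency \<eta> (vf \<kappa>\<^sub>2 \<mu>) (R2 \<eta>) (tangency_point \<kappa>\<^sub>2 \<mu> \<eta>)"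

text \<open>A singular tangency is a point of the switching manifold at which both vector fields
  are tangent to it.\<close>

definition singular_tangency :: "real \<Rightarrow> real \<Rightarrow> real \<Rightarrow> real \<Rightarrow> real \<times> real \<Rightarrow> bool" where
  "singular_tangency \<kappa>\<^sub>1 \<kappa>\<^sub>2 \<mu> \<eta> z \<longleftrightarrow>
     z \<in> switching_manifold \<eta> \<and> vf \<kappa>\<^sub>1 \<mu> z \<bullet> nvec = 0 \<and> vf \<kappa>\<^sub>2 \<mu> z \<bullet> nvec = 0"


section \<open>Sliding\<close>

definition sliding_segment :: "real \<Rightarrow> real \<Rightarrow> real \<Rightarrow> real \<Rightarrow> (real \<times> real) set" where
  "sliding_segment \<kappa>\<^sub>1 \<kappa>\<^sub>2 \<mu> \<eta> =
     {z \<in> switching_manifold \<eta>. (vf \<kappa>\<^sub>1 \<mu> z \<bullet> nvec) * (vf \<kappa>\<^sub>2 \<mu> z \<bullet> nvec) < 0}"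

definition attracting_sliding :: "real \<Rightarrow> real \<Rightarrow> real \<Rightarrow> real \<Rightarrow> (real \<times> real) set" where
  "attracting_sliding \<kappa>\<^sub>1 \<kappa>\<^sub>2 \<mu> \<eta> =
     {z \<in> switching_manifold \<eta>. vf \<kappa>\<^sub>1 \<mu> z \<bullet> nvec > 0 \<and> vf \<kappa>\<^sub>2 \<mu> z \<bullet> nvec < 0}"

definition repelling_sliding :: "real \<Rightarrow> real \<Rightarrow> real \<Rightarrow> real \<Rightarrow> (real \<times> real) set" where
  "repelling_sliding \<kappa>\<^sub>1 \<kappa>\<^sub>2 \<mu> \<eta> =
     {z \<in> switching_manifold \<eta>. vf \<kappa>\<^sub>1 \<mu> z \<bullet> nvec < 0 \<and> vf \<kappa>\<^sub>2 \<mu> z \<bullet> nvec > 0}"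

text \<open>The coefficient \<open>\<lambda>\<close> solves \<open>((1 - \<lambda>) f\<^sub>1 + \<lambda> f\<^sub>2) \<bullet> nvec = 0\<close>; it lies in the unit interval on
  the sliding segment, and elsewhere on the switching manifold it gives the extended expression.
  On the switching manifold the denominator is \<open>\<eta> (\<kappa>\<^sub>2 - \<kappa>\<^sub>1)\<close>. It vanishes for \<open>\<eta> = 0\<close>, where
  the sliding segment is empty and the value below is meaningless.\<close>

definition sliding_field ::
  "real \<Rightarrow> real \<Rightarrow> real \<Rightarrow> real \<Rightarrow> real \<times> real \<Rightarrow> real \<times> real" where
  "sliding_field \<kappa>\<^sub>1 \<kappa>\<^sub>2 \<mu> \<eta> z =
     (let l = (vf \<kappa>\<^sub>1 \<mu> z \<bullet> nvec) / ((vf \<kappa>\<^sub>1 \<mu> z - vf \<kappa>\<^sub>2 \<mu> z) \<bullet> nvec)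
      in (1 - l) *\<^sub>R vf \<kappa>\<^sub>1 \<mu> z + l *\<^sub>R vf \<kappa>\<^sub>2 \<mu> z)"

lemma sliding_field_iff:
  assumes "z \<in> sliding_segment \<kappa>\<^sub>1 \<kappa>\<^sub>2 \<mu> \<eta>"
  shows "(\<exists>l\<in>{0..1}. v = (1 - l) *\<^sub>R vf \<kappa>\<^sub>1 \<mu> z + l *\<^sub>R vf \<kappa>\<^sub>2 \<mu> z \<and> v \<bullet> nvec = 0)
         \<longleftrightarrow> v = sliding_field \<kappa>\<^sub>1 \<kappa>\<^sub>2 \<mu> \<eta> z"
proof -
  define a where "a = vf \<kappa>\<^sub>1 \<mu> z \<bullet> nvec"
  define b where "b = vf \<kappa>\<^sub>2 \<mu> z \<bullet> nvec"
  have ab: "a * b < 0"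
    using assms by (simp add: sliding_segment_def a_def b_def)
  have ne: "a - b \<noteq> 0"
    using ab by (auto simp: mult_less_0_iff)
  have dot: "((1 - l) *\<^sub>R vf \<kappa>\<^sub>1 \<mu> z + l *\<^sub>R vf \<kappa>\<^sub>2 \<mu> z) \<bullet> nvec = (1 - l) * a + l * b" for l
    by (simp add: a_def b_def inner_add_left)
  have root: "(1 - l) * a + l * b = 0 \<longleftrightarrow> l = a / (a - b)" for l
    using ne by (auto simp: field_simps)
  have unit: "a / (a - b) \<in> {0..1}"
    using ab by (auto simp: mult_less_0_iff divide_simps)
  have sf: "sliding_field \<kappa>\<^sub>1 \<kappa>\<^sub>2 \<mu> \<eta> z =
      (1 - a / (a - b)) *\<^sub>R vf \<kappa>\<^sub>1 \<mu> z + (a / (a - b)) *\<^sub>R vf \<kappa>\<^sub>2 \<mu> z"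
    by (simp add: sliding_field_def Let_def a_def b_def inner_diff_left)
  show ?thesis
    using unit unfolding sf by (metis dot root)
qed

definition pseudo_equilibrium :: "real \<Rightarrow> real \<Rightarrow> real \<Rightarrow> real \<Rightarrow> real \<times> real \<Rightarrow> bool" where
  "pseudo_equilibrium \<kappa>\<^sub>1 \<kappa>\<^sub>2 \<mu> \<eta> z \<longleftrightarrow>
     z \<in> switching_manifold \<eta> \<and> (vf \<kappa>\<^sub>1 \<mu> z - vf \<kappa>\<^sub>2 \<mu> z) \<bullet> nvec \<noteq> 0 \<and>
     sliding_field \<kappa>\<^sub>1 \<kappa>\<^sub>2 \<mu> \<eta> z = 0"

definition admissible_pseudo :: "real \<Rightarrow> real \<Rightarrow> real \<Rightarrow> real \<Rightarrow> real \<times> real \<Rightarrow> bool" where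
  "admissible_pseudo \<kappa>\<^sub>1 \<kappa>\<^sub>2 \<mu> \<eta> z \<longleftrightarrow>
     pseudo_equilibrium \<kappa>\<^sub>1 \<kappa>\<^sub>2 \<mu> \<eta> z \<and> z \<in> sliding_segment \<kappa>\<^sub>1 \<kappa>\<^sub>2 \<mu> \<eta>"

text \<open>Since \<^const>\<open>sqrt\<close> is total (and odd), the next two formulas denote points
  also when the radicand is negative; these are then not pseudo-equilibria, by
  \<open>pseudo_equilibrium_iff\<close> below.\<close>

definition q_plus :: "real \<Rightarrow> real \<Rightarrow> real \<times> real" where
  "q_plus \<mu> \<eta> =
     (1 / 2 * (1 - \<mu> - \<eta> + sqrt ((\<eta> + \<mu> + 1)\<^sup>2 - 4 * \<mu>))) *\<^sub>R (1, 1) + (0, \<eta>)"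

definition q_minus :: "real \<Rightarrow> real \<Rightarrow> real \<times> real" where
  "q_minus \<mu> \<eta> =
     (1 / 2 * (1 - \<mu> - \<eta> - sqrt ((\<eta> + \<mu> + 1)\<^sup>2 - 4 * \<mu>))) *\<^sub>R (1, 1) + (0, \<eta>)"

lemma sliding_field_eq:
  assumes "\<kappa>\<^sub>1 \<noteq> \<kappa>\<^sub>2" "\<eta> \<noteq> 0"
  shows "sliding_field \<kappa>\<^sub>1 \<kappa>\<^sub>2 \<mu> \<eta> (x, x + \<eta>) = (1 - x - x * (x - 1 + \<mu>) / \<eta>) *\<^sub>R (1, 1)"
proof -
  define l where "l = (x - (1 - \<mu> + \<eta> * \<kappa>\<^sub>1)) / (\<eta> * (\<kappa>\<^sub>2 - \<kappa>\<^sub>1))"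
  have c: "\<eta> * (\<kappa>\<^sub>2 - \<kappa>\<^sub>1) * l = x - (1 - \<mu> + \<eta> * \<kappa>\<^sub>1)"
    using assms by (simp add: l_def)
  have k: "(1 - l) * \<kappa>\<^sub>1 + l * \<kappa>\<^sub>2 = (x - 1 + \<mu>) / \<eta>"
    using c assms(2) by (simp add: field_simps)
  have l: "(vf \<kappa>\<^sub>1 \<mu> (x, x + \<eta>) \<bullet> nvec) /
        ((vf \<kappa>\<^sub>1 \<mu> (x, x + \<eta>) - vf \<kappa>\<^sub>2 \<mu> (x, x + \<eta>)) \<bullet> nvec) = l"
    by (simp add: vf_def nvec_def l_def algebra_simps)
  have "fst (sliding_field \<kappa>\<^sub>1 \<kappa>\<^sub>2 \<mu> \<eta> (x, x + \<eta>)) = 1 - x - x * ((1 - l) * \<kappa>\<^sub>1 + l * \<kappa>\<^sub>2)"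
    unfolding sliding_field_def l Let_def by (simp add: vf_def algebra_simps)
  moreover have "snd (sliding_field \<kappa>\<^sub>1 \<kappa>\<^sub>2 \<mu> \<eta> (x, x + \<eta>)) =
      \<mu> - (x + \<eta>) * ((1 - l) * \<kappa>\<^sub>1 + l * \<kappa>\<^sub>2)"
    unfolding sliding_field_def l Let_def by (simp add: vf_def algebra_simps)
  ultimately show ?thesis
    unfolding k using assms(2) by (auto simp: prod_eq_iff field_simps)
qed

lemma pseudo_equilibrium_iff:
  assumes "\<kappa>\<^sub>1 \<noteq> \<kappa>\<^sub>2" "\<eta> \<noteq> 0"
  shows "pseudo_equilibrium \<kappa>\<^sub>1 \<kappa>\<^sub>2 \<mu> \<eta> z \<longleftrightarrow>
           (\<eta> + \<mu> + 1)\<^sup>2 - 4 * \<mu> \<ge> 0 \<and> (z = q_plus \<mu> \<eta> \<or> z = q_minus \<mu> \<eta>)"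
proof -
  define D where "D = (\<eta> + \<mu> + 1)\<^sup>2 - 4 * \<mu>"
  have zero: "1 - x - x * (x - 1 + \<mu>) / \<eta> = 0 \<longleftrightarrow> (2 * x - (1 - \<mu> - \<eta>))\<^sup>2 = D" for x
    using assms(2) by (auto simp: D_def field_simps power2_eq_square)
  have sq: "(2 * x - (1 - \<mu> - \<eta>))\<^sup>2 = D \<longleftrightarrow>
      D \<ge> 0 \<and> (x = 1 / 2 * (1 - \<mu> - \<eta> + sqrt D) \<or> x = 1 / 2 * (1 - \<mu> - \<eta> - sqrt D))" for x
  proof
    assume h: "(2 * x - (1 - \<mu> - \<eta>))\<^sup>2 = D"
    then have "sqrt D = \<bar>2 * x - (1 - \<mu> - \<eta>)\<bar>"
      by (metis real_sqrt_abs)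
    moreover have "D \<ge> 0"
      using h by (metis zero_le_power2)
    ultimately show "D \<ge> 0 \<and>
        (x = 1 / 2 * (1 - \<mu> - \<eta> + sqrt D) \<or> x = 1 / 2 * (1 - \<mu> - \<eta> - sqrt D))"
      by (auto simp: abs_if split: if_splits)
  next
    assume "D \<ge> 0 \<and>
        (x = 1 / 2 * (1 - \<mu> - \<eta> + sqrt D) \<or> x = 1 / 2 * (1 - \<mu> - \<eta> - sqrt D))"
    then have "D \<ge> 0" "2 * x - (1 - \<mu> - \<eta>) = sqrt D \<or> 2 * x - (1 - \<mu> - \<eta>) = - sqrt D"
      by auto
    then show "(2 * x - (1 - \<mu> - \<eta>))\<^sup>2 = D"
      by (metis power2_minus real_sqrt_pow2)
  qed
  obtain x y where z: "z = (x, y)"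
    by (cases z)
  have den: "(vf \<kappa>\<^sub>1 \<mu> (x, x + \<eta>) - vf \<kappa>\<^sub>2 \<mu> (x, x + \<eta>)) \<bullet> nvec \<noteq> 0"
    using assms by (simp add: vf_def nvec_def algebra_simps)
  have "pseudo_equilibrium \<kappa>\<^sub>1 \<kappa>\<^sub>2 \<mu> \<eta> z \<longleftrightarrow>
      y = x + \<eta> \<and> 1 - x - x * (x - 1 + \<mu>) / \<eta> = 0"
    using den sliding_field_eq[OF assms, of \<mu> x]
    by (auto simp: z pseudo_equilibrium_def switching_manifold_def zero_prod_def)
  then show ?thesis
    unfolding zero sq
    by (auto simp: z q_plus_def q_minus_def D_def[symmetric])
qed


section \<open>Bifurcations\<close>

definition boundary_equilibrium_bifurcation :: "real \<Rightarrow> real \<Rightarrow> real \<Rightarrow> bool" where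
  "boundary_equilibrium_bifurcation \<kappa> \<mu> \<eta> \<longleftrightarrow> equilibrium \<kappa> \<mu> \<in> switching_manifold \<eta>"

definition fold_fold_bifurcation :: "real \<Rightarrow> real \<Rightarrow> real \<Rightarrow> real \<Rightarrow> bool" where
  "fold_fold_bifurcation \<kappa>\<^sub>1 \<kappa>\<^sub>2 \<mu> \<eta> \<longleftrightarrow> tangency_point \<kappa>\<^sub>1 \<mu> \<eta> = tangency_point \<kappa>\<^sub>2 \<mu> \<eta>"

text \<open>Saddle-node bifurcation of the family of scalar equations \<open>x' = G a x\<close> with parameter \<open>a\<close>:
  an equilibrium with a simple zero eigenvalue, a non-degenerate quadratic term, and an
  equilibrium equation that unfolds transversally in the parameter.\<close>

definition saddle_node :: "('p::real_inner \<Rightarrow> real \<Rightarrow> real) \<Rightarrow> 'p \<Rightarrow> real \<Rightarrow> bool" where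
  "saddle_node G a x \<longleftrightarrow>
     G a x = 0 \<and>
     (\<exists>G' c. (\<forall>\<^sub>F u in nhds x. (G a has_real_derivative G' u) (at u)) \<and> G' x = 0 \<and>
             (G' has_real_derivative c) (at x) \<and> c \<noteq> 0) \<and>
     (\<exists>D. GDERIV (\<lambda>b. G b x) a :> D \<and> D \<noteq> 0)"

text \<open>The switching manifold depends on \<open>\<eta>\<close>; it is parametrized by the abscissa. The sliding
  field is tangent to it, that is a multiple of \<open>(1, 1)\<close>, so that its first component is the
  sliding field in this chart.\<close>

definition pseudo_saddle_node :: "real \<Rightarrow> real \<Rightarrow> real \<Rightarrow> real \<Rightarrow> real \<times> real \<Rightarrow> bool" where
  "pseudo_saddle_node \<kappa>\<^sub>1 \<kappa>\<^sub>2 \<mu> \<eta> z \<longleftrightarrow>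
     z \<in> sliding_segment \<kappa>\<^sub>1 \<kappa>\<^sub>2 \<mu> \<eta> \<and>
     saddle_node (\<lambda>(m, e) x. fst (sliding_field \<kappa>\<^sub>1 \<kappa>\<^sub>2 m e (x, x + e))) (\<mu>, \<eta>) (fst z)"

text \<open>Near the parameter point \<open>w\<close>, the property \<open>P\<close> holds above the curve \<open>\<eta> = c \<mu>\<close> and
  the property \<open>Q\<close> holds below it.\<close>

definition switches_across ::
  "(real \<Rightarrow> real) \<Rightarrow> (real \<Rightarrow> real \<Rightarrow> bool) \<Rightarrow> (real \<Rightarrow> real \<Rightarrow> bool) \<Rightarrow> real \<times> real \<Rightarrow> bool" where
  "switches_across c P Q w \<longleftrightarrow>
     (\<exists>\<epsilon>>0. \<forall>(\<mu>, \<eta>) \<in> ball w \<epsilon>. (\<eta> > c \<mu> \<longrightarrow> P \<mu> \<eta>) \<and> (\<eta> < c \<mu> \<longrightarrow> Q \<mu> \<eta>))"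


section \<open>Bifurcation curves and regions of the parameter plane\<close>

definition be_line :: "real \<Rightarrow> real \<Rightarrow> real" where
  "be_line \<kappa> \<mu> = \<mu> / \<kappa> - 1 / (1 + \<kappa>)"

definition ps_curve :: "real \<Rightarrow> real" where
  "ps_curve \<mu> = - (\<mu> + 1) + 2 * sqrt \<mu>"

definition BE :: "real \<Rightarrow> (real \<times> real) set" where
  "BE \<kappa> = {(\<mu>, \<eta>). \<eta> = be_line \<kappa> \<mu>}"

definition FF :: "(real \<times> real) set" where
  "FF = {(\<mu>, \<eta>). \<eta> = 0}"

definition PS :: "real \<Rightarrow> real \<Rightarrow> (real \<times> real) set" where
  "PS \<kappa>\<^sub>1 \<kappa>\<^sub>2 = {(\<mu>, \<eta>). \<kappa>\<^sub>1\<^sup>2 / (\<kappa>\<^sub>1 + 1)\<^sup>2 < \<mu> \<and> \<mu> < \<kappa>\<^sub>2\<^sup>2 / (\<kappa>\<^sub>2 + 1)\<^sup>2 \<and> \<eta> = ps_curve \<mu>}"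

definition region_I :: "real \<Rightarrow> real \<Rightarrow> (real \<times> real) set" where
  "region_I \<kappa>\<^sub>1 \<kappa>\<^sub>2 = {(\<mu>, \<eta>). \<eta> > 0 \<and> \<eta> > be_line \<kappa>\<^sub>1 \<mu> \<and> \<eta> > be_line \<kappa>\<^sub>2 \<mu>}"

definition region_II :: "real \<Rightarrow> real \<Rightarrow> (real \<times> real) set" where
  "region_II \<kappa>\<^sub>1 \<kappa>\<^sub>2 = {(\<mu>, \<eta>). \<eta> > 0 \<and> be_line \<kappa>\<^sub>2 \<mu> < \<eta> \<and> \<eta> < be_line \<kappa>\<^sub>1 \<mu>}"

definition region_III :: "real \<Rightarrow> real \<Rightarrow> (real \<times> real) set" where
  "region_III \<kappa>\<^sub>1 \<kappa>\<^sub>2 = {(\<mu>, \<eta>). \<eta> > 0 \<and> \<eta> < be_line \<kappa>\<^sub>2 \<mu> \<and> \<eta> < be_line \<kappa>\<^sub>1 \<mu>}"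

definition region_IV :: "real \<Rightarrow> real \<Rightarrow> (real \<times> real) set" where
  "region_IV \<kappa>\<^sub>1 \<kappa>\<^sub>2 = {(\<mu>, \<eta>). \<eta> < 0 \<and> \<eta> > be_line \<kappa>\<^sub>1 \<mu> \<and> \<eta> > be_line \<kappa>\<^sub>2 \<mu>}"

definition region_V :: "real \<Rightarrow> real \<Rightarrow> (real \<times> real) set" where
  "region_V \<kappa>\<^sub>1 \<kappa>\<^sub>2 = {(\<mu>, \<eta>). \<eta> < 0 \<and> be_line \<kappa>\<^sub>2 \<mu> < \<eta> \<and> \<eta> < be_line \<kappa>\<^sub>1 \<mu>}"

definition region_VII :: "real \<Rightarrow> real \<Rightarrow> (real \<times> real) set" where
  "region_VII \<kappa>\<^sub>1 \<kappa>\<^sub>2 = {(\<mu>, \<eta>). \<kappa>\<^sub>1\<^sup>2 / (\<kappa>\<^sub>1 + 1)\<^sup>2 < \<mu> \<and> \<mu> < \<kappa>\<^sub>2\<^sup>2 / (\<kappa>\<^sub>2 + 1)\<^sup>2 \<and>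
     ps_curve \<mu> < \<eta> \<and> \<eta> < min (be_line \<kappa>\<^sub>1 \<mu>) (be_line \<kappa>\<^sub>2 \<mu>)}"

definition region_VI :: "real \<Rightarrow> real \<Rightarrow> (real \<times> real) set" where
  "region_VI \<kappa>\<^sub>1 \<kappa>\<^sub>2 =
     {(\<mu>, \<eta>). \<eta> < 0 \<and> \<eta> < be_line \<kappa>\<^sub>1 \<mu> \<and> \<eta> < be_line \<kappa>\<^sub>2 \<mu>} - closure (region_VII \<kappa>\<^sub>1 \<kappa>\<^sub>2)"

definition region_VIII :: "real \<Rightarrow> real \<Rightarrow> (real \<times> real) set" where
  "region_VIII \<kappa>\<^sub>1 \<kappa>\<^sub>2 = {(\<mu>, \<eta>). \<eta> < 0 \<and> be_line \<kappa>\<^sub>1 \<mu> < \<eta> \<and> \<eta> < be_line \<kappa>\<^sub>2 \<mu>}"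

definition all_regions :: "real \<Rightarrow> real \<Rightarrow> (real \<times> real) set" where
  "all_regions \<kappa>\<^sub>1 \<kappa>\<^sub>2 =
     region_I \<kappa>\<^sub>1 \<kappa>\<^sub>2 \<union> region_II \<kappa>\<^sub>1 \<kappa>\<^sub>2 \<union> region_III \<kappa>\<^sub>1 \<kappa>\<^sub>2 \<union> region_IV \<kappa>\<^sub>1 \<kappa>\<^sub>2 \<union>
     region_V \<kappa>\<^sub>1 \<kappa>\<^sub>2 \<union> region_VI \<kappa>\<^sub>1 \<kappa>\<^sub>2 \<union> region_VII \<kappa>\<^sub>1 \<kappa>\<^sub>2 \<union> region_VIII \<kappa>\<^sub>1 \<kappa>\<^sub>2"

end

theory Submission
  imports Defs
begin

text \<open>Along an orbit through the tangency point \<open>F\<^sub>i\<close> the function \<open>y - x - \<eta>\<close> vanishes to first order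
  and has second derivative \<open>\<kappa>\<^sub>i (1 + \<kappa>\<^sub>i) (b\<^sub>i - \<eta>)\<close>, where \<open>b\<^sub>i\<close> is the value of the line \<open>BE\<^sub>i\<close> at
  \<open>\<mu>\<close>; its sign decides visibility.

  The abscissae of \<open>q\<^sup>\<plusminus>\<close> are the roots of \<open>p(x) = x\<^sup>2 - (1 - \<mu> - \<eta>) x - \<eta>\<close>, and at the abscissa of
  \<open>F\<^sub>i\<close> this polynomial takes the value \<open>\<kappa>\<^sub>i (1 + \<kappa>\<^sub>i) \<eta> (\<eta> - b\<^sub>i)\<close>. Since \<open>F\<^sub>1\<close> and \<open>F\<^sub>2\<close> bound the
  sliding segment, opposite signs of the two values put exactly one root on the segment, and equal
  signs put none or both there. For \<open>\<eta> > 0\<close> the roots have opposite signs and \<open>F\<^sub>i\<close> lies to the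
  right of 0 if \<open>p\<close> is positive there, so that both cannot occur. For \<open>\<eta> < 0\<close> both occur only if \<open>p\<close> is positive at
  both ends, the midpoint of the roots lies between \<open>F\<^sub>1\<close> and \<open>F\<^sub>2\<close>, and the discriminant of \<open>p\<close> is
  nonnegative. This forces \<open>\<mu> > 0\<close>, where the discriminant is
  \<open>(\<eta> + (1 - \<surd>\<mu>)\<^sup>2) (\<eta> + (1 + \<surd>\<mu>)\<^sup>2)\<close>, and leaves region VII and its boundary curve PS, on which the
  two roots merge.\<close>

section \<open>Visibility of the tangency points\<close>

lemma vf_nvec: "vf \<kappa> \<mu> (x, x + \<eta>) \<bullet> nvec = x - (1 - \<mu> + \<eta> * \<kappa>)"
  by (simp add: vf_def nvec_def algebra_simps)

lemma be_line_mult: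
  assumes "\<kappa> > 0"
  shows "\<kappa> * (1 + \<kappa>) * be_line \<kappa> \<mu> = (1 + \<kappa>) * \<mu> - \<kappa>"
  using assms by (simp add: be_line_def divide_simps)

text \<open>The normal component vanishes at the tangency point, so the field there is a multiple of
  \<open>(1, 1)\<close>. The multiplier governs both quadraticity and visibility: it is zero exactly
  on the line BE and its sign tells the side of that line.\<close>

lemma vf_tangency_point:
  assumes "\<kappa> > 0"
  shows "vf \<kappa> \<mu> (tangency_point \<kappa> \<mu> \<eta>) =
    (\<kappa> * (1 + \<kappa>) * (be_line \<kappa> \<mu> - \<eta>)) *\<^sub>R (1, 1)"
proof -
  have "\<kappa> * (1 + \<kappa>) * (be_line \<kappa> \<mu> - \<eta>) = (1 + \<kappa>) * \<mu> - \<kappa> - \<kappa> * (1 + \<kappa>) * \<eta>"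
    using be_line_mult[OF assms, of \<mu>] by (simp add: right_diff_distrib)
  then show ?thesis
    by (simp add: vf_def tangency_point_def algebra_simps)
qed

lemma gderiv_vf_nvec: "GDERIV (\<lambda>w. vf \<kappa> \<mu> w \<bullet> nvec) z :> (1 + \<kappa>, - \<kappa>)"
  unfolding gderiv_def vf_def nvec_def
  by (auto intro!: derivative_eq_intros simp: inner_prod_def algebra_simps)

text \<open>The gradient \<open>(1 + \<kappa>, - \<kappa>)\<close> of the normal component has inner
  product 1 with \<open>(1, 1)\<close>, so the Lie derivative at the tangency point is the
  multiplier in \<open>vf_tangency_point\<close>.\<close>

lemma quadratic_tangency_iff:
  assumes "\<kappa> > 0"
  shows "quadratic_tangency \<eta> (vf \<kappa> \<mu>) (tangency_point \<kappa> \<mu> \<eta>) \<longleftrightarrow> \<eta> \<noteq> be_line \<kappa> \<mu>"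
proof
  assume "quadratic_tangency \<eta> (vf \<kappa> \<mu>) (tangency_point \<kappa> \<mu> \<eta>)"
  \<comment> \<open>On the line the field itself vanishes at the tangency point, which rules out
    every candidate gradient \<open>D\<close>.\<close>
  then show "\<eta> \<noteq> be_line \<kappa> \<mu>"
    by (auto simp: quadratic_tangency_def vf_tangency_point[OF assms])
next
  assume ne: "\<eta> \<noteq> be_line \<kappa> \<mu>"
  have "vf \<kappa> \<mu> (tangency_point \<kappa> \<mu> \<eta>) \<bullet> (1 + \<kappa>, - \<kappa>) \<noteq> 0"
    unfolding vf_tangency_point[OF assms] using assms ne by simp
  then show "quadratic_tangency \<eta> (vf \<kappa> \<mu>) (tangency_point \<kappa> \<mu> \<eta>)"
    using tangency_point_iff[of "tangency_point \<kappa> \<mu> \<eta>" \<eta> \<kappa> \<mu>] gderiv_vf_nvec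
    unfolding quadratic_tangency_def by blast
qed

text \<open>Since \<open>v > 0\<close>, the derivative \<open>h'\<close> is negative just before 0
  and positive just after; the mean value theorem on each side turns this into strict growth of
  \<open>h\<close> away from 0.\<close>

lemma strict_local_min_second_derivative:
  fixes h h' :: "real \<Rightarrow> real"
  assumes h: "\<And>t. (h has_real_derivative h' t) (at t)" and "h' 0 = 0"
    and h': "(h' has_real_derivative v) (at 0)" and "v > 0"
  obtains \<epsilon> where "\<epsilon> > 0" "\<And>t. 0 < \<bar>t\<bar> \<Longrightarrow> \<bar>t\<bar> < \<epsilon> \<Longrightarrow> h 0 < h t"
proof -
  obtain d1 where d1: "d1 > 0" "\<And>s. 0 < s \<Longrightarrow> s < d1 \<Longrightarrow> h' 0 < h' (0 + s)"
    using DERIV_pos_inc_right[OF h' \<open>v > 0\<close>] by blast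
  obtain d2 where d2: "d2 > 0" "\<And>s. 0 < s \<Longrightarrow> s < d2 \<Longrightarrow> h' (0 - s) < h' 0"
    using DERIV_pos_inc_left[OF h' \<open>v > 0\<close>] by blast
  have "h 0 < h t" if t: "0 < \<bar>t\<bar>" "\<bar>t\<bar> < min d1 d2" for t
  proof (cases "t > 0")
    case True
    obtain s where "0 < s" "s < t" "h t - h 0 = (t - 0) * h' s"
      using MVT2[OF True, of h h'] h by blast
    moreover have "h' s > 0"
      using d1(2)[of s] t \<open>0 < s\<close> \<open>s < t\<close> \<open>h' 0 = 0\<close> by simp
    ultimately show ?thesis
      using True by (metis diff_gt_0_iff_gt diff_zero mult_pos_pos)
  next
    case False
    then have "t < 0" using t by auto
    obtain s where s: "t < s" "s < 0" "h 0 - h t = (0 - t) * h' s"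
      using MVT2[OF \<open>t < 0\<close>, of h h'] h by blast
    moreover have "h' s < 0"
      using d2(2)[of "- s"] t s \<open>h' 0 = 0\<close> by simp
    ultimately show ?thesis
      using \<open>t < 0\<close> mult_pos_neg[of "- t" "h' s"] by simp
  qed
  then show thesis
    using that[of "min d1 d2"] d1 d2 by auto
qed

lemma orbit_near_tangency:
  fixes \<phi> :: "real \<Rightarrow> real \<times> real"
  assumes "\<kappa> > 0" and \<phi>0: "\<phi> 0 = tangency_point \<kappa> \<mu> \<eta>"
    and \<phi>: "\<And>t. (\<phi> has_vector_derivative vf \<kappa> \<mu> (\<phi> t)) (at t)"
    and ne: "\<eta> \<noteq> be_line \<kappa> \<mu>"
  obtains \<epsilon> where "\<epsilon> > 0"
    "\<And>t. 0 < \<bar>t\<bar> \<Longrightarrow> \<bar>t\<bar> < \<epsilon> \<Longrightarrow> \<phi> t \<in> (if \<eta> > be_line \<kappa> \<mu> then R1 \<eta> else R2 \<eta>)"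
proof -
  \<comment> \<open>The sign makes the second derivative of \<open>h\<close> positive on either side
    of the line BE, so that one minimum test serves both cases.\<close>
  define \<sigma> :: real where "\<sigma> = (if \<eta> > be_line \<kappa> \<mu> then -1 else 1)"
  define h where "h t = \<sigma> * (snd (\<phi> t) - fst (\<phi> t))" for t
  define h' where "h' t = \<sigma> * (vf \<kappa> \<mu> (\<phi> t) \<bullet> nvec)" for t
  have d1: "((\<lambda>t. fst (\<phi> t)) has_real_derivative fst (vf \<kappa> \<mu> (\<phi> t))) (at t)" for t
    using bounded_linear.has_vector_derivative[OF bounded_linear_fst \<phi>]
    by (simp add: has_real_derivative_iff_has_vector_derivative)
  have d2: "((\<lambda>t. snd (\<phi> t)) has_real_derivative snd (vf \<kappa> \<mu> (\<phi> t))) (at t)" for t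
    using bounded_linear.has_vector_derivative[OF bounded_linear_snd \<phi>]
    by (simp add: has_real_derivative_iff_has_vector_derivative)
  have nv: "w \<bullet> nvec = snd w - fst w" for w
    by (cases w) (simp add: nvec_def)
  have h: "(h has_real_derivative h' t) (at t)" for t
    unfolding h_def h'_def nv
    by (rule DERIV_cmult DERIV_diff d1 d2)+
  have "h' 0 = 0"
    by (simp add: h'_def \<phi>0 nvec_def vf_tangency_point[OF \<open>\<kappa> > 0\<close>])
  have h'_eq: "h' = (\<lambda>t. \<sigma> * ((\<mu> - \<kappa> * snd (\<phi> t)) - (1 - (1 + \<kappa>) * fst (\<phi> t))))"
    by (auto simp: h'_def nv vf_def)
  \<comment> \<open>The normal component is affine, so its derivative along the orbit is its
    gradient applied to the field; at time 0 the field is known from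
    \<open>vf_tangency_point\<close>.\<close>
  have "(h' has_real_derivative
      \<sigma> * ((0 - \<kappa> * snd (vf \<kappa> \<mu> (\<phi> 0))) - (0 - (1 + \<kappa>) * fst (vf \<kappa> \<mu> (\<phi> 0))))) (at 0)"
    unfolding h'_eq by (rule DERIV_cmult DERIV_diff DERIV_const d1 d2)+
  also have "\<sigma> * ((0 - \<kappa> * snd (vf \<kappa> \<mu> (\<phi> 0))) - (0 - (1 + \<kappa>) * fst (vf \<kappa> \<mu> (\<phi> 0)))) =
      \<kappa> * (1 + \<kappa>) * (\<sigma> * (be_line \<kappa> \<mu> - \<eta>))"
    by (simp add: \<phi>0 vf_tangency_point[OF \<open>\<kappa> > 0\<close>] algebra_simps)
  finally have h': "(h' has_real_derivative \<kappa> * (1 + \<kappa>) * (\<sigma> * (be_line \<kappa> \<mu> - \<eta>))) (at 0)" .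
  have "\<kappa> * (1 + \<kappa>) * (\<sigma> * (be_line \<kappa> \<mu> - \<eta>)) > 0"
    using \<open>\<kappa> > 0\<close> ne by (auto simp: \<sigma>_def)
  then obtain \<epsilon> where "\<epsilon> > 0" and pos: "\<And>t. 0 < \<bar>t\<bar> \<Longrightarrow> \<bar>t\<bar> < \<epsilon> \<Longrightarrow> h 0 < h t"
    using strict_local_min_second_derivative[OF h \<open>h' 0 = 0\<close> h'] by metis
  have "h 0 = \<sigma> * \<eta>"
    by (simp add: h_def \<phi>0 tangency_point_def algebra_simps)
  then have "\<phi> t \<in> (if \<eta> > be_line \<kappa> \<mu> then R1 \<eta> else R2 \<eta>)" if "0 < \<bar>t\<bar>" "\<bar>t\<bar> < \<epsilon>" for t
    using pos[OF that] by (cases "\<phi> t") (auto simp: h_def \<sigma>_def R1_def R2_def split: if_splits)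
  then show thesis
    using that \<open>\<epsilon> > 0\<close> by blast
qed

text \<open>The two components decouple into scalar linear equations, solved by exponential
  relaxation to the equilibrium \<open>(X, Y)\<close>.\<close>

lemma orbit_exists:
  assumes "\<kappa> > 0"
  obtains \<phi> :: "real \<Rightarrow> real \<times> real" where
    "\<phi> 0 = z" "\<And>t. (\<phi> has_vector_derivative vf \<kappa> \<mu> (\<phi> t)) (at t)"
proof -
  define X where "X = 1 / (1 + \<kappa>)"
  define Y where "Y = \<mu> / \<kappa>"
  have XY: "(1 + \<kappa>) * X = 1" "\<kappa> * Y = \<mu>"
    using assms by (simp_all add: X_def Y_def)
  define \<phi> where "\<phi> t = (X + (fst z - X) * exp (- (1 + \<kappa>) * t), Y + (snd z - Y) * exp (- \<kappa> * t))" for t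
  have vf: "vf \<kappa> \<mu> (\<phi> t) =
      ((fst z - X) * (exp (- (1 + \<kappa>) * t) * - (1 + \<kappa>)), (snd z - Y) * (exp (- \<kappa> * t) * - \<kappa>))" for t
    using XY unfolding \<phi>_def vf_def fst_conv snd_conv prod.inject
    by (simp add: distrib_left) (simp add: algebra_simps)
  have "(\<phi> has_vector_derivative vf \<kappa> \<mu> (\<phi> t)) (at t)" for t
    unfolding vf unfolding \<phi>_def
    by (rule has_vector_derivative_Pair;
      unfold has_real_derivative_iff_has_vector_derivative[symmetric];
      auto intro!: derivative_eq_intros)
  moreover have "\<phi> 0 = z"
    by (simp add: \<phi>_def)
  ultimately show thesis
    using that by blast
qed

text \<open>By \<open>orbit_near_tangency\<close> every orbit through the tangency point stays, near
  time 0, in the half-plane selected by the sign of \<open>\<eta> - be_line \<kappa> \<mu>\<close>.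
  On the line itself the tangency is not quadratic.\<close>

lemma visible_tangency_iff:
  assumes "\<kappa> > 0"
  shows "visible_tangency \<eta> (vf \<kappa> \<mu>) (R1 \<eta>) (tangency_point \<kappa> \<mu> \<eta>) \<longleftrightarrow> \<eta> > be_line \<kappa> \<mu>" (is ?A)
    and "visible_tangency \<eta> (vf \<kappa> \<mu>) (R2 \<eta>) (tangency_point \<kappa> \<mu> \<eta>) \<longleftrightarrow> \<eta> < be_line \<kappa> \<mu>" (is ?B)
proof -
  let ?z = "tangency_point \<kappa> \<mu> \<eta>" and ?S = "if \<eta> > be_line \<kappa> \<mu> then R1 \<eta> else R2 \<eta>"
  have *: "visible_tangency \<eta> (vf \<kappa> \<mu>) R ?z \<longleftrightarrow> R = ?S"
    if ne: "\<eta> \<noteq> be_line \<kappa> \<mu>" and R: "R = R1 \<eta> \<or> R = R2 \<eta>" for R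
  proof
    assume "visible_tangency \<eta> (vf \<kappa> \<mu>) R ?z"
    then obtain \<phi> \<epsilon> where \<phi>: "\<phi> 0 = ?z" "\<And>t. (\<phi> has_vector_derivative vf \<kappa> \<mu> (\<phi> t)) (at t)"
      and \<epsilon>: "\<epsilon> > 0" "\<And>t. 0 < \<bar>t\<bar> \<Longrightarrow> \<bar>t\<bar> < \<epsilon> \<Longrightarrow> \<phi> t \<in> R"
      unfolding visible_tangency_def by blast
    obtain \<delta> where \<delta>: "\<delta> > 0" "\<And>t. 0 < \<bar>t\<bar> \<Longrightarrow> \<bar>t\<bar> < \<delta> \<Longrightarrow> \<phi> t \<in> ?S"
      using orbit_near_tangency[OF assms \<phi> ne] by blast
    \<comment> \<open>At one small time the orbit lies in both \<open>R\<close> and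
      \<open>?S\<close>; the two half-planes are disjoint, so these must be the same one.\<close>
    obtain t where "0 < t" "t < min \<epsilon> \<delta>"
      using dense[of 0 "min \<epsilon> \<delta>"] \<epsilon> \<delta> by auto
    then have "\<phi> t \<in> R" "\<phi> t \<in> ?S"
      using \<epsilon>(2)[of t] \<delta>(2)[of t] by auto
    then show "R = ?S"
      using R by (auto simp: R1_def R2_def split: if_splits)
  next
    assume "R = ?S"
    moreover obtain \<phi> :: "real \<Rightarrow> real \<times> real" where
      \<phi>: "\<phi> 0 = ?z" "\<And>t. (\<phi> has_vector_derivative vf \<kappa> \<mu> (\<phi> t)) (at t)"
      using orbit_exists[OF assms] by blast
    moreover obtain \<delta> where "\<delta> > 0" "\<And>t. 0 < \<bar>t\<bar> \<Longrightarrow> \<bar>t\<bar> < \<delta> \<Longrightarrow> \<phi> t \<in> ?S"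
      using orbit_near_tangency[OF assms \<phi> ne] by blast
    ultimately show "visible_tangency \<eta> (vf \<kappa> \<mu>) R ?z"
      using quadratic_tangency_iff[OF assms] ne unfolding visible_tangency_def by blast
  qed
  have "(0, \<eta> + 1) \<in> R2 \<eta> - R1 \<eta>"
    by (simp add: R1_def R2_def)
  then have "R1 \<eta> \<noteq> R2 \<eta>"
    by blast
  moreover have "\<eta> \<noteq> be_line \<kappa> \<mu>" if "visible_tangency \<eta> (vf \<kappa> \<mu>) R ?z" for R
    using that quadratic_tangency_iff[OF assms] by (simp add: visible_tangency_def)
  ultimately show ?A ?B
    using * by (metis linorder_neqE order_less_asym)+
qed

section \<open>The sliding segment\<close>

lemma mem_sliding_segment_iff:
  "(x, y) \<in> sliding_segment \<kappa>\<^sub>1 \<kappa>\<^sub>2 \<mu> \<eta> \<longleftrightarrow>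
     y = x + \<eta> \<and> (x - (1 - \<mu> + \<eta> * \<kappa>\<^sub>1)) * (x - (1 - \<mu> + \<eta> * \<kappa>\<^sub>2)) < 0"
  using vf_nvec[of _ \<mu> x \<eta>] by (auto simp: sliding_segment_def switching_manifold_def)

text \<open>By \<open>vf_nvec\<close> each normal component is the abscissa minus that of the
  tangency point, so opposite signs mean lying strictly between the two. For
  \<open>\<eta> = 0\<close> both sides are empty.\<close>

lemma sliding_segment_eq_open_segment:
  "sliding_segment \<kappa>\<^sub>1 \<kappa>\<^sub>2 \<mu> \<eta> =
     open_segment (tangency_point \<kappa>\<^sub>1 \<mu> \<eta>) (tangency_point \<kappa>\<^sub>2 \<mu> \<eta>)"
proof (rule set_eqI)
  fix z :: "real \<times> real"
  obtain x y where z: "z = (x, y)" by (cases z)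
  define a where "a = 1 - \<mu> + \<eta> * \<kappa>\<^sub>1"
  define b where "b = 1 - \<mu> + \<eta> * \<kappa>\<^sub>2"
  have T: "tangency_point \<kappa>\<^sub>1 \<mu> \<eta> = (a, a + \<eta>)" "tangency_point \<kappa>\<^sub>2 \<mu> \<eta> = (b, b + \<eta>)"
    by (simp_all add: tangency_point_def a_def b_def algebra_simps)
  have "z \<in> open_segment (a, a + \<eta>) (b, b + \<eta>) \<longleftrightarrow> y = x + \<eta> \<and> x \<in> open_segment a b"
    unfolding z in_segment by (auto simp: algebra_simps)
  also have "x \<in> open_segment a b \<longleftrightarrow> (x - a) * (x - b) < 0"
    by (auto simp: open_segment_eq_real_ivl mult_less_0_iff)
  finally show "z \<in> sliding_segment \<kappa>\<^sub>1 \<kappa>\<^sub>2 \<mu> \<eta> \<longleftrightarrow>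
      z \<in> open_segment (tangency_point \<kappa>\<^sub>1 \<mu> \<eta>) (tangency_point \<kappa>\<^sub>2 \<mu> \<eta>)"
    unfolding T z mem_sliding_segment_iff a_def b_def by blast
qed

lemma tangency_points_coincide_iff:
  assumes "\<kappa>\<^sub>1 \<noteq> \<kappa>\<^sub>2"
  shows "tangency_point \<kappa>\<^sub>1 \<mu> \<eta> = tangency_point \<kappa>\<^sub>2 \<mu> \<eta> \<longleftrightarrow> \<eta> = 0"
  using assms by (auto simp: tangency_point_def)

text \<open>For \<open>\<eta> > 0\<close> the point F1 is to the left of F2, hence between them the
  first normal component is positive and the second negative.\<close>

lemma attracting_sliding_segment:
  assumes "\<kappa>\<^sub>1 < \<kappa>\<^sub>2" "\<eta> > 0"
  shows "sliding_segment \<kappa>\<^sub>1 \<kappa>\<^sub>2 \<mu> \<eta> = attracting_sliding \<kappa>\<^sub>1 \<kappa>\<^sub>2 \<mu> \<eta>"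
proof -
  have "\<eta> * \<kappa>\<^sub>1 < \<eta> * \<kappa>\<^sub>2" using assms by simp
  then show ?thesis
    by (auto simp: sliding_segment_def attracting_sliding_def switching_manifold_def vf_nvec
        mult_less_0_iff)
qed

lemma repelling_sliding_segment:
  assumes "\<kappa>\<^sub>1 < \<kappa>\<^sub>2" "\<eta> < 0"
  shows "sliding_segment \<kappa>\<^sub>1 \<kappa>\<^sub>2 \<mu> \<eta> = repelling_sliding \<kappa>\<^sub>1 \<kappa>\<^sub>2 \<mu> \<eta>"
proof -
  have "\<eta> * \<kappa>\<^sub>2 < \<eta> * \<kappa>\<^sub>1" using assms by simp
  then show ?thesis
    by (auto simp: sliding_segment_def repelling_sliding_def switching_manifold_def vf_nvec
        mult_less_0_iff)
qed

section \<open>Pseudo-equilibria\<close>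

definition discr :: "real \<Rightarrow> real \<Rightarrow> real" where
  "discr \<mu> \<eta> = (\<eta> + \<mu> + 1)\<^sup>2 - 4 * \<mu>"

text \<open>Twice the signed distance of the abscissa of the tangency point to the midpoint of the
  two pseudo-equilibria.\<close>

definition offset :: "real \<Rightarrow> real \<Rightarrow> real \<Rightarrow> real" where
  "offset \<kappa> \<mu> \<eta> = 1 - \<mu> + \<eta> * (2 * \<kappa> + 1)"

text \<open>This is the discriminant of p in its usual form; it shows at once that
  \<open>\<eta> > 0\<close> gives real roots.\<close>

lemma discr_eq: "discr \<mu> \<eta> = (1 - \<mu> - \<eta>)\<^sup>2 + 4 * \<eta>"
  by (simp add: discr_def power2_eq_square algebra_simps)

text \<open>An instance of completing the square: if \<open>offset\<close> is twice the distance of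
  x to the midpoint of the roots, then its square minus the discriminant is 4 p(x).\<close>

lemma offset_square:
  assumes "\<kappa> > 0"
  shows "(offset \<kappa> \<mu> \<eta>)\<^sup>2 = discr \<mu> \<eta> + 4 * \<kappa> * (1 + \<kappa>) * (\<eta> * (\<eta> - be_line \<kappa> \<mu>))"
proof -
  have "\<kappa> * (1 + \<kappa>) * (\<eta> - be_line \<kappa> \<mu>) = \<kappa> * (1 + \<kappa>) * \<eta> - ((1 + \<kappa>) * \<mu> - \<kappa>)"
    using be_line_mult[OF assms, of \<mu>] by (simp add: right_diff_distrib)
  then have "4 * \<kappa> * (1 + \<kappa>) * (\<eta> * (\<eta> - be_line \<kappa> \<mu>)) =
      4 * \<eta> * (\<kappa> * (1 + \<kappa>) * \<eta> - ((1 + \<kappa>) * \<mu> - \<kappa>))"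
    by algebra
  then show ?thesis
    by (simp add: offset_def discr_def power2_eq_square algebra_simps)
qed

lemma offset_square_compare:
  assumes "\<kappa> > 0"
  shows "discr \<mu> \<eta> < (offset \<kappa> \<mu> \<eta>)\<^sup>2 \<longleftrightarrow> 0 < \<eta> * (\<eta> - be_line \<kappa> \<mu>)"
    and "(offset \<kappa> \<mu> \<eta>)\<^sup>2 < discr \<mu> \<eta> \<longleftrightarrow> \<eta> * (\<eta> - be_line \<kappa> \<mu>) < 0"
  using assms by (simp_all add: offset_square zero_less_mult_iff mult_less_0_iff)

text \<open>In the coordinate of \<open>offset\<close> the roots sit at plus and minus
  \<open>sqrt (discr \<mu> \<eta>)\<close>. Being on the sliding segment thus means lying strictly
  between the two offsets.\<close>

lemma admissible_pseudo_iff: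
  assumes "\<kappa>\<^sub>1 \<noteq> \<kappa>\<^sub>2" "\<eta> \<noteq> 0"
  shows "admissible_pseudo \<kappa>\<^sub>1 \<kappa>\<^sub>2 \<mu> \<eta> (q_plus \<mu> \<eta>) \<longleftrightarrow> discr \<mu> \<eta> \<ge> 0 \<and>
      (sqrt (discr \<mu> \<eta>) - offset \<kappa>\<^sub>1 \<mu> \<eta>) * (sqrt (discr \<mu> \<eta>) - offset \<kappa>\<^sub>2 \<mu> \<eta>) < 0"
    and "admissible_pseudo \<kappa>\<^sub>1 \<kappa>\<^sub>2 \<mu> \<eta> (q_minus \<mu> \<eta>) \<longleftrightarrow> discr \<mu> \<eta> \<ge> 0 \<and>
      (sqrt (discr \<mu> \<eta>) + offset \<kappa>\<^sub>1 \<mu> \<eta>) * (sqrt (discr \<mu> \<eta>) + offset \<kappa>\<^sub>2 \<mu> \<eta>) < 0"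
proof -
  define r where "r = sqrt (discr \<mu> \<eta>)"
  have seg: "(x, x + \<eta>) \<in> sliding_segment \<kappa>\<^sub>1 \<kappa>\<^sub>2 \<mu> \<eta> \<longleftrightarrow>
      (s - offset \<kappa>\<^sub>1 \<mu> \<eta>) * (s - offset \<kappa>\<^sub>2 \<mu> \<eta>) < 0"
    if "x = 1 / 2 * (1 - \<mu> - \<eta> + s)" for x s
  proof -
    have "x - (1 - \<mu> + \<eta> * \<kappa>) = (s - offset \<kappa> \<mu> \<eta>) / 2" for \<kappa>
      unfolding offset_def that by (simp add: field_simps)
    then have "(x - (1 - \<mu> + \<eta> * \<kappa>\<^sub>1)) * (x - (1 - \<mu> + \<eta> * \<kappa>\<^sub>2)) =
        (s - offset \<kappa>\<^sub>1 \<mu> \<eta>) / 2 * ((s - offset \<kappa>\<^sub>2 \<mu> \<eta>) / 2)"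
      by (simp only:)
    then show ?thesis
      unfolding mem_sliding_segment_iff by linarith
  qed
  \<comment> \<open>Both points are put in the shape required by \<open>seg\<close>, with
    \<open>s = r\<close> and \<open>s = - r\<close>.\<close>
  have q: "q_plus \<mu> \<eta> = (1 / 2 * (1 - \<mu> - \<eta> + r), 1 / 2 * (1 - \<mu> - \<eta> + r) + \<eta>)"
    "q_minus \<mu> \<eta> = (1 / 2 * (1 - \<mu> - \<eta> + - r), 1 / 2 * (1 - \<mu> - \<eta> + - r) + \<eta>)"
    by (simp_all add: q_plus_def q_minus_def r_def discr_def)
  show "admissible_pseudo \<kappa>\<^sub>1 \<kappa>\<^sub>2 \<mu> \<eta> (q_plus \<mu> \<eta>) \<longleftrightarrow> discr \<mu> \<eta> \<ge> 0 \<and>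
      (sqrt (discr \<mu> \<eta>) - offset \<kappa>\<^sub>1 \<mu> \<eta>) * (sqrt (discr \<mu> \<eta>) - offset \<kappa>\<^sub>2 \<mu> \<eta>) < 0"
    unfolding admissible_pseudo_def pseudo_equilibrium_iff[OF assms] discr_def[symmetric]
      r_def[symmetric] seg[OF refl, symmetric] q(1)[symmetric]
    by simp
  have "admissible_pseudo \<kappa>\<^sub>1 \<kappa>\<^sub>2 \<mu> \<eta> (q_minus \<mu> \<eta>) \<longleftrightarrow> discr \<mu> \<eta> \<ge> 0 \<and>
      (- r - offset \<kappa>\<^sub>1 \<mu> \<eta>) * (- r - offset \<kappa>\<^sub>2 \<mu> \<eta>) < 0"
    unfolding admissible_pseudo_def pseudo_equilibrium_iff[OF assms] discr_def[symmetric]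
      seg[OF refl, symmetric] q(2)[symmetric]
    by simp
  moreover have "(- r - a) * (- r - b) = (r + a) * (r + b)" for a b
    by algebra
  ultimately show "admissible_pseudo \<kappa>\<^sub>1 \<kappa>\<^sub>2 \<mu> \<eta> (q_minus \<mu> \<eta>) \<longleftrightarrow> discr \<mu> \<eta> \<ge> 0 \<and>
      (sqrt (discr \<mu> \<eta>) + offset \<kappa>\<^sub>1 \<mu> \<eta>) * (sqrt (discr \<mu> \<eta>) + offset \<kappa>\<^sub>2 \<mu> \<eta>) < 0"
    unfolding r_def by simp
qed

lemma offset_less:
  assumes "\<kappa>\<^sub>1 < \<kappa>\<^sub>2"
  shows "\<eta> > 0 \<Longrightarrow> offset \<kappa>\<^sub>1 \<mu> \<eta> < offset \<kappa>\<^sub>2 \<mu> \<eta>"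
    and "\<eta> < 0 \<Longrightarrow> offset \<kappa>\<^sub>2 \<mu> \<eta> < offset \<kappa>\<^sub>1 \<mu> \<eta>"
  using assms by (simp_all add: offset_def)

text \<open>Taking roots in \<open>offset_square_compare\<close>: a positive value of p puts the
  tangency point outside the two roots, a negative value between them.\<close>

lemma sqrt_discr_cases:
  assumes "\<kappa> > 0" "discr \<mu> \<eta> \<ge> 0"
  shows "0 < \<eta> * (\<eta> - be_line \<kappa> \<mu>) \<Longrightarrow>
      offset \<kappa> \<mu> \<eta> < - sqrt (discr \<mu> \<eta>) \<or> sqrt (discr \<mu> \<eta>) < offset \<kappa> \<mu> \<eta>"
    and "\<eta> * (\<eta> - be_line \<kappa> \<mu>) < 0 \<Longrightarrow>
      - sqrt (discr \<mu> \<eta>) < offset \<kappa> \<mu> \<eta> \<and> offset \<kappa> \<mu> \<eta> < sqrt (discr \<mu> \<eta>)"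
proof -
  show "offset \<kappa> \<mu> \<eta> < - sqrt (discr \<mu> \<eta>) \<or> sqrt (discr \<mu> \<eta>) < offset \<kappa> \<mu> \<eta>"
    if "0 < \<eta> * (\<eta> - be_line \<kappa> \<mu>)"
  proof -
    have "sqrt (discr \<mu> \<eta>) < \<bar>offset \<kappa> \<mu> \<eta>\<bar>"
      using that offset_square_compare(1)[OF assms(1)] by (metis real_sqrt_abs real_sqrt_less_iff)
    then show ?thesis by linarith
  qed
  show "- sqrt (discr \<mu> \<eta>) < offset \<kappa> \<mu> \<eta> \<and> offset \<kappa> \<mu> \<eta> < sqrt (discr \<mu> \<eta>)"
    if "\<eta> * (\<eta> - be_line \<kappa> \<mu>) < 0"
  proof -
    have "\<bar>offset \<kappa> \<mu> \<eta>\<bar> < sqrt (discr \<mu> \<eta>)"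
      using that offset_square_compare(2)[OF assms(1)] by (metis real_sqrt_abs real_sqrt_less_iff)
    then show ?thesis by linarith
  qed
qed

lemma discr_pos:
  assumes "\<kappa> > 0" "\<eta> * (\<eta> - be_line \<kappa> \<mu>) < 0"
  shows "discr \<mu> \<eta> > 0"
  using offset_square_compare(2)[OF assms(1), of \<mu> \<eta>] assms(2)
  by (meson le_less_trans zero_le_power2)

section \<open>The curve PS relative to the boundary equilibrium lines\<close>

text \<open>The difference is a positive multiple of a square in \<open>sqrt \<mu>\<close>, so the
  line lies above PS except at one point of contact.\<close>

lemma be_line_minus_ps_curve:
  assumes "\<kappa> > 0" "\<mu> \<ge> 0"
  shows "be_line \<kappa> \<mu> - ps_curve \<mu> = (1 + \<kappa>) / \<kappa> * (sqrt \<mu> - \<kappa> / (\<kappa> + 1))\<^sup>2"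
proof -
  \<comment> \<open>With \<open>\<mu> = s\<^sup>2\<close> the claim becomes a rational identity in
    \<open>s\<close> and \<open>\<kappa>\<close>.\<close>
  define s where "s = sqrt \<mu>"
  have "be_line \<kappa> (s\<^sup>2) - (- (s\<^sup>2 + 1) + 2 * s) = (1 + \<kappa>) / \<kappa> * (s - \<kappa> / (\<kappa> + 1))\<^sup>2"
    using assms(1)
    by (simp add: be_line_def divide_simps) (simp add: power2_eq_square algebra_simps)
  then show ?thesis
    by (simp add: ps_curve_def s_def assms)
qed

lemma sqrt_compare_tangent:
  assumes "\<kappa> > 0" "\<mu> \<ge> 0"
  shows "\<kappa>\<^sup>2 / (\<kappa> + 1)\<^sup>2 < \<mu> \<longleftrightarrow> \<kappa> / (\<kappa> + 1) < sqrt \<mu>"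
    and "\<mu> < \<kappa>\<^sup>2 / (\<kappa> + 1)\<^sup>2 \<longleftrightarrow> sqrt \<mu> < \<kappa> / (\<kappa> + 1)"
  using assms real_sqrt_less_iff[of \<mu> "(\<kappa> / (\<kappa> + 1))\<^sup>2"]
    real_sqrt_less_iff[of "(\<kappa> / (\<kappa> + 1))\<^sup>2" \<mu>]
  by (simp_all add: power_divide[symmetric])

text \<open>\<open>\<mu> = \<kappa>\<^sup>2 / (\<kappa> + 1)\<^sup>2\<close> is the point where the boundary equilibrium line touches the curve PS.\<close>

lemma be_line_offset:
  assumes "\<kappa> > 0"
  shows "offset \<kappa> \<mu> (be_line \<kappa> \<mu>) = (\<kappa> + 1) / \<kappa> * (\<mu> - \<kappa>\<^sup>2 / (\<kappa> + 1)\<^sup>2)"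
  using assms
  by (simp add: offset_def be_line_def divide_simps) (simp add: power2_eq_square algebra_simps)

lemma offset_mono: "\<kappa> > 0 \<Longrightarrow> \<eta> \<le> \<eta>' \<Longrightarrow> offset \<kappa> \<mu> \<eta> \<le> offset \<kappa> \<mu> \<eta>'"
  by (simp add: offset_def mult_right_mono)

text \<open>For \<open>\<mu> < 1\<close> the first factor is positive and the last one, which
  vanishes at the contact point with the line BE, decides the sign.\<close>

lemma ps_curve_offset:
  assumes "\<mu> \<ge> 0"
  shows "offset \<kappa> \<mu> (ps_curve \<mu>) = 2 * (1 - sqrt \<mu>) * ((1 + \<kappa>) * sqrt \<mu> - \<kappa>)"
proof -
  define s where "s = sqrt \<mu>"
  have "offset \<kappa> (s\<^sup>2) (- (s\<^sup>2 + 1) + 2 * s) = 2 * (1 - s) * ((1 + \<kappa>) * s - \<kappa>)"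
    by (simp add: offset_def power2_eq_square algebra_simps)
  then show ?thesis
    by (simp add: ps_curve_def s_def assms)
qed

text \<open>The discriminant is a difference of the squares of \<open>\<eta> + \<mu> + 1\<close> and
  \<open>2 * sqrt \<mu>\<close>; one factor vanishes on PS.\<close>

lemma discr_factor:
  assumes "\<mu> \<ge> 0"
  shows "discr \<mu> \<eta> = (\<eta> - ps_curve \<mu>) * (\<eta> + (1 + sqrt \<mu>)\<^sup>2)"
proof -
  define s where "s = sqrt \<mu>"
  have "discr (s\<^sup>2) \<eta> = (\<eta> - (- (s\<^sup>2 + 1) + 2 * s)) * (\<eta> + (1 + s)\<^sup>2)"
    by (simp add: discr_def power2_eq_square algebra_simps)
  then show ?thesis
    by (simp add: ps_curve_def s_def assms)
qed

text \<open>A nonnegative discriminant leaves only \<open>\<eta>\<close> on or above PS, or at most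
  \<open>- (1 + sqrt \<mu>)\<^sup>2\<close>. The offset is monotone in \<open>\<eta>\<close> and not
  positive at the latter bound, which excludes the lower branch.\<close>

lemma above_ps_curve:
  assumes "\<kappa> > 0" "\<mu> \<ge> 0" "discr \<mu> \<eta> \<ge> 0" "0 < offset \<kappa> \<mu> \<eta>"
  shows "ps_curve \<mu> \<le> \<eta>"
proof -
  define s where "s = sqrt \<mu>"
  have s: "s \<ge> 0" "\<mu> = s\<^sup>2" using assms by (simp_all add: s_def)
  have "\<eta> > - (1 + s)\<^sup>2"
  proof (rule ccontr)
    assume "\<not> \<eta> > - (1 + s)\<^sup>2"
    then have "0 < offset \<kappa> \<mu> (- (1 + s)\<^sup>2)"
      using offset_mono[OF assms(1), of \<eta> "- (1 + s)\<^sup>2" \<mu>] assms(4) by linarith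
    also have "offset \<kappa> \<mu> (- (1 + s)\<^sup>2) = - (2 * (1 + s) * (s + \<kappa> * (1 + s)))"
      by (simp add: s(2) offset_def power2_eq_square algebra_simps)
    also have "\<dots> \<le> 0"
      using s(1) assms(1) by (simp add: mult_nonneg_nonneg)
    finally show False
      by simp
  qed
  then have "\<eta> + (1 + sqrt \<mu>)\<^sup>2 > 0"
    by (simp add: s_def)
  with assms(3) show ?thesis
    unfolding discr_factor[OF assms(2)] by (simp add: zero_le_mult_iff)
qed

text \<open>At abscissa 1 the quadratic polynomial whose roots are the pseudo-equilibria has value \<open>\<mu>\<close>;
  for \<open>\<mu> \<le> 0\<close> the point 1 thus separates them, while below the boundary equilibrium line the
  tangency point has abscissa less than 1.\<close>

lemma mu_pos:
  assumes "\<kappa> > 0" "\<eta> < 0" "\<eta> < be_line \<kappa> \<mu>" "0 < offset \<kappa> \<mu> \<eta>"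
  shows "\<mu> > 0"
proof (rule ccontr)
  assume "\<not> \<mu> > 0"
  \<comment> \<open>In the coordinate of \<open>offset\<close>, the abscissa 1 corresponds to
    \<open>1 + \<mu> + \<eta>\<close>.\<close>
  then have le: "(1 + \<mu> + \<eta>)\<^sup>2 \<le> discr \<mu> \<eta>"
    by (simp add: discr_def add_ac)
  have "\<kappa> * (1 + \<kappa>) * \<eta> < \<kappa> * (1 + \<kappa>) * be_line \<kappa> \<mu>"
    using assms(1,3) by simp
  also have "\<dots> < (1 + \<kappa>) * \<mu>"
    unfolding be_line_mult[OF assms(1)] using assms(1) by simp
  finally have "(1 + \<kappa>) * (\<kappa> * \<eta>) < (1 + \<kappa>) * \<mu>"
    by (simp add: mult_ac)
  then have "\<kappa> * \<eta> < \<mu>"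
    using assms(1) by simp
  then have "offset \<kappa> \<mu> \<eta> < 1 + \<mu> + \<eta>"
    by (simp add: offset_def algebra_simps)
  then have "(offset \<kappa> \<mu> \<eta>)\<^sup>2 < (1 + \<mu> + \<eta>)\<^sup>2"
    using assms(4) by (intro power_strict_mono) auto
  moreover have "discr \<mu> \<eta> < (offset \<kappa> \<mu> \<eta>)\<^sup>2"
    using offset_square_compare(1)[OF assms(1)] assms(2,3) by (simp add: zero_less_mult_iff)
  ultimately show False
    using le by linarith
qed

text \<open>Monotonicity carries the negative sign down to PS, where \<open>ps_curve_offset\<close>
  turns it into a bound on \<open>\<mu>\<close>.\<close>

lemma offset_neg_imp:
  assumes "\<kappa> > 0" "\<mu> > 0" "\<eta> < 0" "ps_curve \<mu> \<le> \<eta>" "offset \<kappa> \<mu> \<eta> < 0" "\<mu> < 1"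
  shows "\<mu> < \<kappa>\<^sup>2 / (\<kappa> + 1)\<^sup>2"
proof -
  have "sqrt \<mu> < 1" using assms by simp
  have "offset \<kappa> \<mu> (ps_curve \<mu>) < 0"
    using offset_mono[OF assms(1,4), of \<mu>] assms(5) by linarith
  then have "(1 + \<kappa>) * sqrt \<mu> < \<kappa>"
    using \<open>sqrt \<mu> < 1\<close> assms(2) by (simp add: ps_curve_offset mult_less_0_iff)
  then show ?thesis
    using assms(1,2) by (subst sqrt_compare_tangent) (simp_all add: field_simps)
qed

text \<open>Monotonicity carries the positive sign up to the line BE, where the offset is an
  increasing affine function of \<open>\<mu>\<close>.\<close>

lemma offset_pos_imp:
  assumes "\<kappa> > 0" "\<eta> < be_line \<kappa> \<mu>" "0 < offset \<kappa> \<mu> \<eta>"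
  shows "\<kappa>\<^sup>2 / (\<kappa> + 1)\<^sup>2 < \<mu>"
proof -
  have "0 < offset \<kappa> \<mu> (be_line \<kappa> \<mu>)"
    using offset_mono[OF assms(1), of \<eta> "be_line \<kappa> \<mu>" \<mu>] assms by linarith
  then have "0 < (\<kappa> + 1) / \<kappa> * (\<mu> - \<kappa>\<^sup>2 / (\<kappa> + 1)\<^sup>2)"
    unfolding be_line_offset[OF assms(1)] .
  then have "0 < \<mu> - \<kappa>\<^sup>2 / (\<kappa> + 1)\<^sup>2"
    by (rule zero_less_mult_pos) (use assms(1) in simp)
  then show ?thesis by simp
qed

text \<open>This confines the case of two admissible roots to region VII and PS. F1 supplies the
  lower bound on \<open>\<mu>\<close> and, with the discriminant, the bound by PS; F2 supplies the
  upper bound on \<open>\<mu>\<close>.\<close>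

lemma both_offsets_imp:
  assumes "0 < \<kappa>\<^sub>1" "0 < \<kappa>\<^sub>2" "\<eta> < 0" "\<eta> < be_line \<kappa>\<^sub>1 \<mu>" "discr \<mu> \<eta> \<ge> 0"
    "offset \<kappa>\<^sub>2 \<mu> \<eta> < 0" "0 < offset \<kappa>\<^sub>1 \<mu> \<eta>"
  shows "\<kappa>\<^sub>1\<^sup>2 / (\<kappa>\<^sub>1 + 1)\<^sup>2 < \<mu>" "\<mu> < \<kappa>\<^sub>2\<^sup>2 / (\<kappa>\<^sub>2 + 1)\<^sup>2" "ps_curve \<mu> \<le> \<eta>"
proof -
  have \<mu>: "\<mu> > 0"
    using mu_pos[OF assms(1,3,4,7)] .
  show ps: "ps_curve \<mu> \<le> \<eta>"
    using above_ps_curve[OF assms(1) _ assms(5,7)] \<mu> by simp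
  show "\<kappa>\<^sub>1\<^sup>2 / (\<kappa>\<^sub>1 + 1)\<^sup>2 < \<mu>"
    using offset_pos_imp[OF assms(1,4,7)] .
  have "\<eta> * (2 * \<kappa>\<^sub>1 + 1) < 0"
    using assms by (simp add: mult_less_0_iff)
  then have "\<mu> < 1"
    using assms(7) by (simp add: offset_def)
  then show "\<mu> < \<kappa>\<^sub>2\<^sup>2 / (\<kappa>\<^sub>2 + 1)\<^sup>2"
    using offset_neg_imp[OF assms(2) \<mu> assms(3) ps assms(6)] by simp
qed

lemma window_bounds:
  fixes \<mu> :: real
  assumes "0 < \<kappa>\<^sub>1" "0 < \<kappa>\<^sub>2" "\<kappa>\<^sub>1\<^sup>2 / (\<kappa>\<^sub>1 + 1)\<^sup>2 < \<mu>" "\<mu> < \<kappa>\<^sub>2\<^sup>2 / (\<kappa>\<^sub>2 + 1)\<^sup>2"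
  shows "0 < \<mu>" "\<kappa>\<^sub>1 / (\<kappa>\<^sub>1 + 1) < sqrt \<mu>" "sqrt \<mu> < \<kappa>\<^sub>2 / (\<kappa>\<^sub>2 + 1)" "sqrt \<mu> < 1"
    "ps_curve \<mu> < 0" "ps_curve \<mu> < be_line \<kappa>\<^sub>1 \<mu>" "ps_curve \<mu> < be_line \<kappa>\<^sub>2 \<mu>"
    "be_line \<kappa>\<^sub>2 \<mu> < 0"
proof -
  have "0 < \<kappa>\<^sub>1\<^sup>2 / (\<kappa>\<^sub>1 + 1)\<^sup>2"
    using assms(1) by simp
  then show \<mu>: "0 < \<mu>" using assms(3) by linarith
  show s1: "\<kappa>\<^sub>1 / (\<kappa>\<^sub>1 + 1) < sqrt \<mu>" and s2: "sqrt \<mu> < \<kappa>\<^sub>2 / (\<kappa>\<^sub>2 + 1)"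
    using sqrt_compare_tangent assms \<mu> by simp_all
  have "\<kappa>\<^sub>2 / (\<kappa>\<^sub>2 + 1) < 1"
    using assms(2) by simp
  then show s: "sqrt \<mu> < 1"
    using s2 by linarith
  have "ps_curve \<mu> = - (1 - sqrt \<mu>)\<^sup>2"
    using \<mu> by (simp add: ps_curve_def power2_diff)
  then show "ps_curve \<mu> < 0"
    using s by simp
  have "0 < be_line \<kappa>\<^sub>1 \<mu> - ps_curve \<mu>" "0 < be_line \<kappa>\<^sub>2 \<mu> - ps_curve \<mu>"
    using be_line_minus_ps_curve[OF assms(1), of \<mu>] be_line_minus_ps_curve[OF assms(2), of \<mu>]
      \<mu> assms(1,2) s1 s2 by simp_all
  then show "ps_curve \<mu> < be_line \<kappa>\<^sub>1 \<mu>" "ps_curve \<mu> < be_line \<kappa>\<^sub>2 \<mu>"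
    by simp_all
  \<comment> \<open>The line increases with \<open>\<mu>\<close>, and at its contact point with PS
    its value is \<open>- 1 / (\<kappa>\<^sub>2 + 1)\<^sup>2\<close>.\<close>
  have "be_line \<kappa>\<^sub>2 \<mu> < be_line \<kappa>\<^sub>2 (\<kappa>\<^sub>2\<^sup>2 / (\<kappa>\<^sub>2 + 1)\<^sup>2)"
    unfolding be_line_def using divide_strict_right_mono[OF assms(4,2)] by simp
  also have "\<dots> < 0"
    using assms(2) add_pos_pos[of \<kappa>\<^sub>2 "\<kappa>\<^sub>2 * \<kappa>\<^sub>2"]
    by (simp add: be_line_def divide_simps) (simp add: power2_eq_square algebra_simps)
  finally show "be_line \<kappa>\<^sub>2 \<mu> < 0" .
qed

text \<open>A converse to \<open>both_offsets_imp\<close>: by monotonicity it suffices to check F2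
  at the upper limit BE2 and F1 at the lower limit PS.\<close>

lemma offset_signs:
  assumes "0 < \<kappa>\<^sub>1" "0 < \<kappa>\<^sub>2" "\<kappa>\<^sub>1\<^sup>2 / (\<kappa>\<^sub>1 + 1)\<^sup>2 < \<mu>" "\<mu> < \<kappa>\<^sub>2\<^sup>2 / (\<kappa>\<^sub>2 + 1)\<^sup>2"
    "ps_curve \<mu> \<le> \<eta>" "\<eta> < be_line \<kappa>\<^sub>2 \<mu>"
  shows "offset \<kappa>\<^sub>2 \<mu> \<eta> < 0" "0 < offset \<kappa>\<^sub>1 \<mu> \<eta>"
proof -
  note w = window_bounds[OF assms(1-4)]
  have "offset \<kappa>\<^sub>2 \<mu> \<eta> \<le> offset \<kappa>\<^sub>2 \<mu> (be_line \<kappa>\<^sub>2 \<mu>)"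
    using offset_mono assms by simp
  also have "\<dots> < 0"
    unfolding be_line_offset[OF assms(2)] using assms(2,4) by (intro mult_pos_neg) simp_all
  finally show "offset \<kappa>\<^sub>2 \<mu> \<eta> < 0" .
  have "(1 + \<kappa>\<^sub>1) * sqrt \<mu> > \<kappa>\<^sub>1"
    using w(2) assms(1) by (simp add: field_simps)
  then have "0 < offset \<kappa>\<^sub>1 \<mu> (ps_curve \<mu>)"
    using w by (simp add: ps_curve_offset zero_less_mult_iff)
  also have "\<dots> \<le> offset \<kappa>\<^sub>1 \<mu> \<eta>"
    using offset_mono assms by simp
  finally show "0 < offset \<kappa>\<^sub>1 \<mu> \<eta>" .
qed

section \<open>Admissibility of the pseudo-equilibria, region by region\<close>

text \<open>Here p is positive at both ends of the segment, its real roots are distinct, and their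
  midpoint lies between the ends, so both roots do too.\<close>

lemma region_VII_admissible:
  assumes "0 < \<kappa>\<^sub>1" "\<kappa>\<^sub>1 < \<kappa>\<^sub>2" "(\<mu>, \<eta>) \<in> region_VII \<kappa>\<^sub>1 \<kappa>\<^sub>2"
  shows "\<eta> < 0" "discr \<mu> \<eta> > 0"
    "admissible_pseudo \<kappa>\<^sub>1 \<kappa>\<^sub>2 \<mu> \<eta> (q_plus \<mu> \<eta>)" "admissible_pseudo \<kappa>\<^sub>1 \<kappa>\<^sub>2 \<mu> \<eta> (q_minus \<mu> \<eta>)"
proof -
  have k2: "0 < \<kappa>\<^sub>2" using assms by simp
  have h: "\<kappa>\<^sub>1\<^sup>2 / (\<kappa>\<^sub>1 + 1)\<^sup>2 < \<mu>" "\<mu> < \<kappa>\<^sub>2\<^sup>2 / (\<kappa>\<^sub>2 + 1)\<^sup>2" "ps_curve \<mu> < \<eta>"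
    "\<eta> < be_line \<kappa>\<^sub>1 \<mu>" "\<eta> < be_line \<kappa>\<^sub>2 \<mu>"
    using assms(3) by (simp_all add: region_VII_def)
  note w = window_bounds[OF assms(1) k2 h(1,2)]
  show \<eta>: "\<eta> < 0" using w(8) h by linarith
  \<comment> \<open>This makes the second factor of \<open>discr_factor\<close> positive above
    PS.\<close>
  have "- (1 + sqrt \<mu>)\<^sup>2 \<le> ps_curve \<mu>"
    using w(1) by (simp add: ps_curve_def power2_sum)
  then show D: "discr \<mu> \<eta> > 0"
    using discr_factor[of \<mu> \<eta>] w(1) h by (auto simp: zero_less_mult_iff)
  have o: "offset \<kappa>\<^sub>2 \<mu> \<eta> < 0" "0 < offset \<kappa>\<^sub>1 \<mu> \<eta>"
    using offset_signs[OF assms(1) k2 h(1,2)] h by auto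
  have "0 < \<eta> * (\<eta> - be_line \<kappa>\<^sub>1 \<mu>)" "0 < \<eta> * (\<eta> - be_line \<kappa>\<^sub>2 \<mu>)"
    using \<eta> h by (simp_all add: zero_less_mult_iff)
  then have "sqrt (discr \<mu> \<eta>) < offset \<kappa>\<^sub>1 \<mu> \<eta>" "offset \<kappa>\<^sub>2 \<mu> \<eta> < - sqrt (discr \<mu> \<eta>)"
    using sqrt_discr_cases(1)[OF assms(1), of \<mu> \<eta>] sqrt_discr_cases(1)[OF k2, of \<mu> \<eta>] D o
      real_sqrt_ge_zero[of "discr \<mu> \<eta>"] by linarith+
  moreover have "sqrt (discr \<mu> \<eta>) > 0"
    using D by simp
  ultimately have
    "(sqrt (discr \<mu> \<eta>) - offset \<kappa>\<^sub>1 \<mu> \<eta>) * (sqrt (discr \<mu> \<eta>) - offset \<kappa>\<^sub>2 \<mu> \<eta>) < 0"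
    "(sqrt (discr \<mu> \<eta>) + offset \<kappa>\<^sub>1 \<mu> \<eta>) * (sqrt (discr \<mu> \<eta>) + offset \<kappa>\<^sub>2 \<mu> \<eta>) < 0"
    by (intro mult_neg_pos mult_pos_neg; linarith)+
  then show "admissible_pseudo \<kappa>\<^sub>1 \<kappa>\<^sub>2 \<mu> \<eta> (q_plus \<mu> \<eta>)"
    "admissible_pseudo \<kappa>\<^sub>1 \<kappa>\<^sub>2 \<mu> \<eta> (q_minus \<mu> \<eta>)"
    using D \<eta> assms(2) by (simp_all add: admissible_pseudo_iff)
qed

lemma region_VI_not_admissible:
  assumes "0 < \<kappa>\<^sub>1" "\<kappa>\<^sub>1 < \<kappa>\<^sub>2" "(\<mu>, \<eta>) \<in> region_VI \<kappa>\<^sub>1 \<kappa>\<^sub>2"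
  shows "\<not> admissible_pseudo \<kappa>\<^sub>1 \<kappa>\<^sub>2 \<mu> \<eta> (q_plus \<mu> \<eta>)"
    "\<not> admissible_pseudo \<kappa>\<^sub>1 \<kappa>\<^sub>2 \<mu> \<eta> (q_minus \<mu> \<eta>)"
proof -
  have k2: "0 < \<kappa>\<^sub>2" using assms by simp
  have h: "\<eta> < 0" "\<eta> < be_line \<kappa>\<^sub>1 \<mu>" "\<eta> < be_line \<kappa>\<^sub>2 \<mu>" "(\<mu>, \<eta>) \<notin> closure (region_VII \<kappa>\<^sub>1 \<kappa>\<^sub>2)"
    using assms(3) by (simp_all add: region_VI_def)
  define r where "r = sqrt (discr \<mu> \<eta>)"
  have False if D: "discr \<mu> \<eta> \<ge> 0"
    and seg: "(r - offset \<kappa>\<^sub>1 \<mu> \<eta>) * (r - offset \<kappa>\<^sub>2 \<mu> \<eta>) < 0 \<or>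
      (r + offset \<kappa>\<^sub>1 \<mu> \<eta>) * (r + offset \<kappa>\<^sub>2 \<mu> \<eta>) < 0"
  proof -
    have "r \<ge> 0" using D by (simp add: r_def)
    have "0 < \<eta> * (\<eta> - be_line \<kappa>\<^sub>1 \<mu>)" "0 < \<eta> * (\<eta> - be_line \<kappa>\<^sub>2 \<mu>)"
      using h by (simp_all add: zero_less_mult_iff)
    then have "offset \<kappa>\<^sub>1 \<mu> \<eta> < - r \<or> r < offset \<kappa>\<^sub>1 \<mu> \<eta>" "offset \<kappa>\<^sub>2 \<mu> \<eta> < - r \<or> r < offset \<kappa>\<^sub>2 \<mu> \<eta>"
      using sqrt_discr_cases(1)[OF _ D] assms(1) k2 unfolding r_def by blast+
    \<comment> \<open>Both offsets avoid the interval from \<open>- r\<close> to \<open>r\<close>; a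
      root strictly between them forces them to opposite sides of it, and \<open>offset_less\<close>
      tells which is which.\<close>
    with seg offset_less(2)[OF assms(2) h(1), of \<mu>] \<open>r \<ge> 0\<close>
    have o: "offset \<kappa>\<^sub>2 \<mu> \<eta> < 0" "0 < offset \<kappa>\<^sub>1 \<mu> \<eta>"
      by (auto simp: mult_less_0_iff)
    note b = both_offsets_imp[OF assms(1) k2 h(1,2) D o]
    \<comment> \<open>By \<open>b\<close> the point \<open>(\<mu>, \<eta>)\<close> may lie on PS
      rather than in region VII. The open vertical segment just above it is in region VII, and that
      puts the point in the closure.\<close>
    define bound where "bound = min (be_line \<kappa>\<^sub>1 \<mu>) (be_line \<kappa>\<^sub>2 \<mu>)"
    have "(\<mu>, e) \<in> region_VII \<kappa>\<^sub>1 \<kappa>\<^sub>2" if "\<eta> < e" "e < bound" for e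
      using that b by (simp add: region_VII_def bound_def)
    then have "{\<mu>} \<times> {\<eta><..<bound} \<subseteq> region_VII \<kappa>\<^sub>1 \<kappa>\<^sub>2"
      by auto
    then have "closure ({\<mu>} \<times> {\<eta><..<bound}) \<subseteq> closure (region_VII \<kappa>\<^sub>1 \<kappa>\<^sub>2)"
      by (rule closure_mono)
    moreover have "\<eta> < bound" using h by (simp add: bound_def)
    then have "(\<mu>, \<eta>) \<in> closure ({\<mu>} \<times> {\<eta><..<bound})"
      by (simp add: closure_Times)
    ultimately show False
      using h(4) by blast
  qed
  then show "\<not> admissible_pseudo \<kappa>\<^sub>1 \<kappa>\<^sub>2 \<mu> \<eta> (q_plus \<mu> \<eta>)"
    "\<not> admissible_pseudo \<kappa>\<^sub>1 \<kappa>\<^sub>2 \<mu> \<eta> (q_minus \<mu> \<eta>)"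
    using assms(2) h(1) unfolding r_def by (auto simp: admissible_pseudo_iff)
qed

text \<open>The tangency point has positive abscissa, and 0 lies between the pseudo-equilibria,
  because the product of their abscissae is \<open>- \<eta>\<close>.\<close>

lemma offset_gt_q_minus:
  assumes "\<kappa> > 0" "\<eta> > 0" "be_line \<kappa> \<mu> < \<eta>"
  shows "- sqrt (discr \<mu> \<eta>) < offset \<kappa> \<mu> \<eta>"
proof -
  have "(1 + \<kappa>) * \<mu> - \<kappa> < \<kappa> * (1 + \<kappa>) * \<eta>"
    unfolding be_line_mult[OF assms(1), symmetric] using assms(1,3) by simp
  then have "0 < (1 + \<kappa>) * (1 - \<mu> + \<kappa> * \<eta>)"
    by (simp add: algebra_simps)
  then have "1 - \<mu> + \<kappa> * \<eta> > 0"
    using assms(1) by (simp add: zero_less_mult_iff)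
  \<comment> \<open>The left side is the abscissa 0 in the coordinate of
    \<open>offset\<close>.\<close>
  then have "- (1 - \<mu> - \<eta>) < offset \<kappa> \<mu> \<eta>"
    by (simp add: offset_def algebra_simps)
  moreover have "\<bar>1 - \<mu> - \<eta>\<bar> \<le> sqrt (discr \<mu> \<eta>)"
    using assms(2) by (intro real_le_rsqrt) (simp add: discr_eq)
  ultimately show ?thesis by linarith
qed

text \<open>The signs of p at the ends differ. For either sign of \<open>\<eta>\<close> the end with
  negative value is the left one, so the root on the segment is the larger.\<close>

lemma opposite_sides_admissible:
  assumes "0 < \<kappa>\<^sub>1" "\<kappa>\<^sub>1 < \<kappa>\<^sub>2" "\<eta> \<noteq> 0" "be_line \<kappa>\<^sub>2 \<mu> < \<eta>" "\<eta> < be_line \<kappa>\<^sub>1 \<mu>"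
  shows "admissible_pseudo \<kappa>\<^sub>1 \<kappa>\<^sub>2 \<mu> \<eta> (q_plus \<mu> \<eta>)"
    "\<not> admissible_pseudo \<kappa>\<^sub>1 \<kappa>\<^sub>2 \<mu> \<eta> (q_minus \<mu> \<eta>)"
proof -
  have k2: "0 < \<kappa>\<^sub>2" using assms by simp
  define r where "r = sqrt (discr \<mu> \<eta>)"
  have "discr \<mu> \<eta> \<ge> 0 \<and>
      (- r < offset \<kappa>\<^sub>1 \<mu> \<eta> \<and> offset \<kappa>\<^sub>1 \<mu> \<eta> < r \<and> r < offset \<kappa>\<^sub>2 \<mu> \<eta> \<or>
       - r < offset \<kappa>\<^sub>2 \<mu> \<eta> \<and> offset \<kappa>\<^sub>2 \<mu> \<eta> < r \<and> r < offset \<kappa>\<^sub>1 \<mu> \<eta>)"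
  proof (cases "\<eta> > 0")
    case True
    then have s: "\<eta> * (\<eta> - be_line \<kappa>\<^sub>1 \<mu>) < 0" "0 < \<eta> * (\<eta> - be_line \<kappa>\<^sub>2 \<mu>)"
      using assms by (simp_all add: zero_less_mult_iff mult_less_0_iff)
    have D: "discr \<mu> \<eta> \<ge> 0"
      using discr_pos[OF assms(1) s(1)] by simp
    show ?thesis
      using D sqrt_discr_cases(2)[OF assms(1) D s(1)] sqrt_discr_cases(1)[OF k2 D s(2)]
        offset_less(1)[OF assms(2) True, of \<mu>] unfolding r_def by linarith
  next
    case False
    then have \<eta>: "\<eta> < 0" using assms by simp
    then have s: "\<eta> * (\<eta> - be_line \<kappa>\<^sub>2 \<mu>) < 0" "0 < \<eta> * (\<eta> - be_line \<kappa>\<^sub>1 \<mu>)"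
      using assms by (simp_all add: zero_less_mult_iff mult_less_0_iff)
    have D: "discr \<mu> \<eta> \<ge> 0"
      using discr_pos[OF k2 s(1)] by simp
    show ?thesis
      using D sqrt_discr_cases(2)[OF k2 D s(1)] sqrt_discr_cases(1)[OF assms(1) D s(2)]
        offset_less(2)[OF assms(2) \<eta>, of \<mu>] unfolding r_def by linarith
  qed
  then show "admissible_pseudo \<kappa>\<^sub>1 \<kappa>\<^sub>2 \<mu> \<eta> (q_plus \<mu> \<eta>)"
    "\<not> admissible_pseudo \<kappa>\<^sub>1 \<kappa>\<^sub>2 \<mu> \<eta> (q_minus \<mu> \<eta>)"
    unfolding admissible_pseudo_iff[OF less_imp_neq[OF assms(2)] assms(3)] r_def[symmetric]
      mult_less_0_iff by linarith+
qed

text \<open>Now p is positive at the left end F2 and negative at the right end F1, so the segment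
  contains only the smaller root.\<close>

lemma region_VIII_admissible:
  assumes "0 < \<kappa>\<^sub>1" "\<kappa>\<^sub>1 < \<kappa>\<^sub>2" "(\<mu>, \<eta>) \<in> region_VIII \<kappa>\<^sub>1 \<kappa>\<^sub>2"
  shows "\<not> admissible_pseudo \<kappa>\<^sub>1 \<kappa>\<^sub>2 \<mu> \<eta> (q_plus \<mu> \<eta>)"
    "admissible_pseudo \<kappa>\<^sub>1 \<kappa>\<^sub>2 \<mu> \<eta> (q_minus \<mu> \<eta>)"
proof -
  have k2: "0 < \<kappa>\<^sub>2" using assms by simp
  have h: "\<eta> < 0" "be_line \<kappa>\<^sub>1 \<mu> < \<eta>" "\<eta> < be_line \<kappa>\<^sub>2 \<mu>"
    using assms(3) by (simp_all add: region_VIII_def)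
  define r where "r = sqrt (discr \<mu> \<eta>)"
  have s: "\<eta> * (\<eta> - be_line \<kappa>\<^sub>1 \<mu>) < 0" "0 < \<eta> * (\<eta> - be_line \<kappa>\<^sub>2 \<mu>)"
    using h by (simp_all add: zero_less_mult_iff mult_less_0_iff)
  have D: "discr \<mu> \<eta> \<ge> 0"
    using discr_pos[OF assms(1) s(1)] by simp
  have "- r < offset \<kappa>\<^sub>1 \<mu> \<eta>" "offset \<kappa>\<^sub>1 \<mu> \<eta> < r" "offset \<kappa>\<^sub>2 \<mu> \<eta> < - r"
    using sqrt_discr_cases(2)[OF assms(1) D s(1)] sqrt_discr_cases(1)[OF k2 D s(2)]
      offset_less(2)[OF assms(2) h(1), of \<mu>] unfolding r_def by linarith+
  with D show "\<not> admissible_pseudo \<kappa>\<^sub>1 \<kappa>\<^sub>2 \<mu> \<eta> (q_plus \<mu> \<eta>)"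
    "admissible_pseudo \<kappa>\<^sub>1 \<kappa>\<^sub>2 \<mu> \<eta> (q_minus \<mu> \<eta>)"
    unfolding admissible_pseudo_iff[OF less_imp_neq[OF assms(2)] less_imp_neq[OF h(1)]]
      r_def[symmetric] mult_less_0_iff by linarith+
qed

text \<open>In region I both ends lie to the right of the two roots; in regions III and IV both ends
  lie between the roots. In neither case is a root on the segment.\<close>

lemma not_admissible:
  assumes "0 < \<kappa>\<^sub>1" "\<kappa>\<^sub>1 < \<kappa>\<^sub>2"
    "(\<mu>, \<eta>) \<in> region_I \<kappa>\<^sub>1 \<kappa>\<^sub>2 \<union> region_III \<kappa>\<^sub>1 \<kappa>\<^sub>2 \<union> region_IV \<kappa>\<^sub>1 \<kappa>\<^sub>2"
  shows "\<not> admissible_pseudo \<kappa>\<^sub>1 \<kappa>\<^sub>2 \<mu> \<eta> (q_plus \<mu> \<eta>)"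
    "\<not> admissible_pseudo \<kappa>\<^sub>1 \<kappa>\<^sub>2 \<mu> \<eta> (q_minus \<mu> \<eta>)"
proof -
  have k2: "0 < \<kappa>\<^sub>2" using assms by simp
  define r where "r = sqrt (discr \<mu> \<eta>)"
  have "\<eta> \<noteq> 0"
    using assms(3) by (auto simp: region_I_def region_III_def region_IV_def)
  have "- r < offset \<kappa>\<^sub>1 \<mu> \<eta> \<and> - r < offset \<kappa>\<^sub>2 \<mu> \<eta> \<and>
      (offset \<kappa>\<^sub>1 \<mu> \<eta> < r \<longleftrightarrow> offset \<kappa>\<^sub>2 \<mu> \<eta> < r) \<and> offset \<kappa>\<^sub>1 \<mu> \<eta> \<noteq> r" if D: "discr \<mu> \<eta> \<ge> 0"
  proof (cases "(\<mu>, \<eta>) \<in> region_I \<kappa>\<^sub>1 \<kappa>\<^sub>2")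
    case True
    then have h: "\<eta> > 0" "be_line \<kappa>\<^sub>1 \<mu> < \<eta>" "be_line \<kappa>\<^sub>2 \<mu> < \<eta>"
      by (simp_all add: region_I_def)
    then have "0 < \<eta> * (\<eta> - be_line \<kappa>\<^sub>1 \<mu>)" "0 < \<eta> * (\<eta> - be_line \<kappa>\<^sub>2 \<mu>)"
      by simp_all
    note s = this
    show ?thesis
      using sqrt_discr_cases(1)[OF assms(1) D s(1)] sqrt_discr_cases(1)[OF k2 D s(2)]
        offset_gt_q_minus[OF assms(1) h(1,2)] offset_gt_q_minus[OF k2 h(1,3)]
      unfolding r_def by linarith
  next
    case False
    then have "\<eta> * (\<eta> - be_line \<kappa>\<^sub>1 \<mu>) < 0" "\<eta> * (\<eta> - be_line \<kappa>\<^sub>2 \<mu>) < 0"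
      using assms(3) by (auto simp: region_III_def region_IV_def mult_less_0_iff)
    note s = this
    show ?thesis
      using sqrt_discr_cases(2)[OF assms(1) D s(1)] sqrt_discr_cases(2)[OF k2 D s(2)]
      unfolding r_def by linarith
  qed
  then show "\<not> admissible_pseudo \<kappa>\<^sub>1 \<kappa>\<^sub>2 \<mu> \<eta> (q_plus \<mu> \<eta>)"
    "\<not> admissible_pseudo \<kappa>\<^sub>1 \<kappa>\<^sub>2 \<mu> \<eta> (q_minus \<mu> \<eta>)"
    unfolding admissible_pseudo_iff[OF less_imp_neq[OF assms(2)] \<open>\<eta> \<noteq> 0\<close>]
      r_def[symmetric] mult_less_0_iff by linarith+
qed

section \<open>The pseudo-saddle-node bifurcation\<close>

lemma fst_sliding_field:
  assumes "\<kappa>\<^sub>1 \<noteq> \<kappa>\<^sub>2" "\<eta> \<noteq> 0"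
  shows "fst (sliding_field \<kappa>\<^sub>1 \<kappa>\<^sub>2 \<mu> \<eta> (x, x + \<eta>)) = 1 - x - x * (x - 1 + \<mu>) / \<eta>"
  by (simp add: sliding_field_eq[OF assms])

lemma gderiv_sliding_field:
  assumes "\<kappa>\<^sub>1 \<noteq> \<kappa>\<^sub>2" "\<eta> \<noteq> 0"
  shows "GDERIV (\<lambda>(m, e). fst (sliding_field \<kappa>\<^sub>1 \<kappa>\<^sub>2 m e (x, x + e))) (\<mu>, \<eta>) :>
    (- (x / \<eta>), x * (x - 1 + \<mu>) / \<eta>\<^sup>2)"
proof -
  have "((\<lambda>w. 1 - x - x * (x - 1 + fst w) / snd w) has_derivative
      (\<lambda>h. h \<bullet> (- (x / \<eta>), x * (x - 1 + \<mu>) / \<eta>\<^sup>2))) (at (\<mu>, \<eta>))"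
    using assms(2)
    by (auto intro!: derivative_eq_intros simp: inner_prod_def field_simps power2_eq_square)
  \<comment> \<open>The explicit formula for the sliding field is available only for nonzero
    \<open>\<eta>\<close>, so the derivative is transferred on this open set.\<close>
  moreover have "open {w :: real \<times> real. snd w \<noteq> 0}"
    by (intro open_Collect_neq continuous_intros)
  ultimately show ?thesis
    unfolding gderiv_def
    by (rule has_derivative_transform_within_open)
      (use assms in \<open>auto simp: fst_sliding_field\<close>)
qed

text \<open>The scalar field is - p(x) / \<open>\<eta>\<close>, with second derivative
  \<open>- 2 / \<eta>\<close>, so the condition reduces to a double root of p; the parameter
  gradient is nonzero there.\<close>

lemma saddle_node_iff:
  assumes "\<kappa>\<^sub>1 \<noteq> \<kappa>\<^sub>2" "\<eta> \<noteq> 0"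
  shows "saddle_node (\<lambda>(m, e) x. fst (sliding_field \<kappa>\<^sub>1 \<kappa>\<^sub>2 m e (x, x + e))) (\<mu>, \<eta>) x \<longleftrightarrow>
    2 * x = 1 - \<mu> - \<eta> \<and> discr \<mu> \<eta> = 0" (is "saddle_node ?G _ _ \<longleftrightarrow> _")
proof -
  define G' where "G' x = - 1 - (2 * x - 1 + \<mu>) / \<eta>" for x
  have G: "?G (\<mu>, \<eta>) = (\<lambda>x. 1 - x - x * (x - 1 + \<mu>) / \<eta>)"
    using fst_sliding_field[OF assms] by auto
  have dG: "(?G (\<mu>, \<eta>) has_real_derivative G' u) (at u)" for u
    unfolding G G'_def using assms(2)
    by (auto intro!: derivative_eq_intros simp: field_simps)
  have dG': "(G' has_real_derivative - 2 / \<eta>) (at u)" for u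
    unfolding G'_def using assms(2)
    by (auto intro!: derivative_eq_intros simp: field_simps)
  have G'0: "G' x = 0 \<longleftrightarrow> 2 * x = 1 - \<mu> - \<eta>"
    using assms(2) by (auto simp: G'_def field_simps)
  have G0: "?G (\<mu>, \<eta>) x = 0 \<longleftrightarrow> (2 * x - (1 - \<mu> - \<eta>))\<^sup>2 = discr \<mu> \<eta>"
    unfolding G discr_eq using assms(2) by (auto simp: field_simps power2_eq_square)
  show ?thesis
  proof
    assume sn: "saddle_node ?G (\<mu>, \<eta>) x"
    then have "?G (\<mu>, \<eta>) x = 0"
      and "\<exists>g c. (\<forall>\<^sub>F u in nhds x. (?G (\<mu>, \<eta>) has_real_derivative g u) (at u)) \<and> g x = 0 \<and>
             (g has_real_derivative c) (at x) \<and> c \<noteq> 0"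
      unfolding saddle_node_def by (rule conjunct1, elim conjE)
    then obtain g where g: "\<forall>\<^sub>F u in nhds x. (?G (\<mu>, \<eta>) has_real_derivative g u) (at u)" "g x = 0"
      by (elim exE conjE)
    \<comment> \<open>The derivative function in \<open>saddle_node\<close> is existential;
      uniqueness of the derivative at \<open>x\<close> identifies its value with
      \<open>G' x\<close>.\<close>
    have "(?G (\<mu>, \<eta>) has_real_derivative 0) (at x)"
      using eventually_nhds_x_imp_x[OF g(1)] g(2) by simp
    then have "G' x = 0"
      using DERIV_unique[OF dG] by simp
    then show "2 * x = 1 - \<mu> - \<eta> \<and> discr \<mu> \<eta> = 0"
      using \<open>?G (\<mu>, \<eta>) x = 0\<close> G'0 unfolding G0 by simp
  next
    assume *: "2 * x = 1 - \<mu> - \<eta> \<and> discr \<mu> \<eta> = 0"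
    then have 0: "?G (\<mu>, \<eta>) x = 0"
      using G0 by simp
    \<comment> \<open>At abscissa 0 the scalar field has the value 1.\<close>
    then have "x \<noteq> 0"
      unfolding G by auto
    then have "(- (x / \<eta>), x * (x - 1 + \<mu>) / \<eta>\<^sup>2) \<noteq> 0"
      using assms(2) by (simp add: zero_prod_def)
    moreover have "- 2 / \<eta> \<noteq> 0"
      using assms(2) by simp
    moreover have "GDERIV (\<lambda>b. ?G b x) (\<mu>, \<eta>) :> (- (x / \<eta>), x * (x - 1 + \<mu>) / \<eta>\<^sup>2)"
      using gderiv_sliding_field[OF assms, of x \<mu>] by (simp add: case_prod_unfold)
    moreover have "\<forall>\<^sub>F u in nhds x. (?G (\<mu>, \<eta>) has_real_derivative G' u) (at u)"
      using dG by simp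
    ultimately show "saddle_node ?G (\<mu>, \<eta>) x"
      unfolding saddle_node_def using 0 dG' G'0 * by blast
  qed
qed

text \<open>A double root is the midpoint, so it is on the segment exactly when the offsets have
  opposite signs. The two directions then come from \<open>both_offsets_imp\<close> and
  \<open>offset_signs\<close>.\<close>

lemma pseudo_saddle_node_iff:
  assumes "0 < \<kappa>\<^sub>1" "\<kappa>\<^sub>1 < \<kappa>\<^sub>2"
  shows "pseudo_saddle_node \<kappa>\<^sub>1 \<kappa>\<^sub>2 \<mu> \<eta> z \<longleftrightarrow>
    (\<mu>, \<eta>) \<in> PS \<kappa>\<^sub>1 \<kappa>\<^sub>2 \<and> z = (1 - sqrt \<mu>) *\<^sub>R (1, 1) + (0, \<eta>)"
proof -
  have k2: "0 < \<kappa>\<^sub>2" using assms by simp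
  obtain x y where z: "z = (x, y)" by (cases z)
  have seg: "(x, x + \<eta>) \<in> sliding_segment \<kappa>\<^sub>1 \<kappa>\<^sub>2 \<mu> \<eta> \<longleftrightarrow> offset \<kappa>\<^sub>1 \<mu> \<eta> * offset \<kappa>\<^sub>2 \<mu> \<eta> < 0"
    if "2 * x = 1 - \<mu> - \<eta>"
  proof -
    have "offset \<kappa>\<^sub>1 \<mu> \<eta> * offset \<kappa>\<^sub>2 \<mu> \<eta> =
        4 * ((x - (1 - \<mu> + \<eta> * \<kappa>\<^sub>1)) * (x - (1 - \<mu> + \<eta> * \<kappa>\<^sub>2)))"
      unfolding offset_def using that by algebra
    then show ?thesis
      by (simp add: mem_sliding_segment_iff)
  qed
  show ?thesis
  proof
    assume sn: "pseudo_saddle_node \<kappa>\<^sub>1 \<kappa>\<^sub>2 \<mu> \<eta> z"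
    then have mem: "(x, y) \<in> sliding_segment \<kappa>\<^sub>1 \<kappa>\<^sub>2 \<mu> \<eta>"
      by (simp add: pseudo_saddle_node_def z)
    then have y: "y = x + \<eta>"
      by (simp add: mem_sliding_segment_iff)
    \<comment> \<open>For \<open>\<eta> = 0\<close> the product defining the sliding segment would
      be a square.\<close>
    have ne: "\<eta> \<noteq> 0"
      using mem by (auto simp: mem_sliding_segment_iff)
    have x: "2 * x = 1 - \<mu> - \<eta>" and D: "discr \<mu> \<eta> = 0"
      using sn saddle_node_iff[of \<kappa>\<^sub>1 \<kappa>\<^sub>2 \<eta>] ne assms(2) by (auto simp: pseudo_saddle_node_def z)
    have o: "offset \<kappa>\<^sub>1 \<mu> \<eta> * offset \<kappa>\<^sub>2 \<mu> \<eta> < 0"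
      using seg x mem y by simp
    have "\<eta> < 0"
      using D ne zero_le_power2[of "1 - \<mu> - \<eta>"] unfolding discr_eq by linarith
    then have o: "offset \<kappa>\<^sub>2 \<mu> \<eta> < 0" "0 < offset \<kappa>\<^sub>1 \<mu> \<eta>"
      using o offset_less(2)[OF assms(2), of \<eta> \<mu>] by (auto simp: mult_less_0_iff)
    have "\<eta> < be_line \<kappa>\<^sub>1 \<mu>"
      using offset_square_compare(1)[OF assms(1), of \<mu> \<eta>] o D \<open>\<eta> < 0\<close>
      by (simp add: zero_less_mult_iff)
    note b = both_offsets_imp[OF assms(1) k2 \<open>\<eta> < 0\<close> this _ o]
    have b: "\<kappa>\<^sub>1\<^sup>2 / (\<kappa>\<^sub>1 + 1)\<^sup>2 < \<mu>" "\<mu> < \<kappa>\<^sub>2\<^sup>2 / (\<kappa>\<^sub>2 + 1)\<^sup>2" "ps_curve \<mu> \<le> \<eta>"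
      using b D by simp_all
    note w = window_bounds[OF assms(1) k2 b(1,2)]
    have "- (1 + sqrt \<mu>)\<^sup>2 < ps_curve \<mu>"
      using w(1) by (simp add: ps_curve_def power2_sum)
    then have \<eta>: "\<eta> = ps_curve \<mu>"
      using D b(3) discr_factor[of \<mu> \<eta>] w(1) by auto
    then have "(\<mu>, \<eta>) \<in> PS \<kappa>\<^sub>1 \<kappa>\<^sub>2"
      using b by (simp add: PS_def)
    moreover have "x = 1 - sqrt \<mu>"
      using x by (simp add: \<eta> ps_curve_def)
    ultimately show "(\<mu>, \<eta>) \<in> PS \<kappa>\<^sub>1 \<kappa>\<^sub>2 \<and> z = (1 - sqrt \<mu>) *\<^sub>R (1, 1) + (0, \<eta>)"
      by (simp add: z y)
  next
    assume "(\<mu>, \<eta>) \<in> PS \<kappa>\<^sub>1 \<kappa>\<^sub>2 \<and> z = (1 - sqrt \<mu>) *\<^sub>R (1, 1) + (0, \<eta>)"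
    then have b: "\<kappa>\<^sub>1\<^sup>2 / (\<kappa>\<^sub>1 + 1)\<^sup>2 < \<mu>" "\<mu> < \<kappa>\<^sub>2\<^sup>2 / (\<kappa>\<^sub>2 + 1)\<^sup>2" "\<eta> = ps_curve \<mu>"
      and xy: "x = 1 - sqrt \<mu>" "y = x + \<eta>"
      by (auto simp: PS_def z)
    note w = window_bounds[OF assms(1) k2 b(1,2)]
    have x: "2 * x = 1 - \<mu> - \<eta>"
      by (simp add: xy b ps_curve_def)
    have "\<eta> \<noteq> 0" "discr \<mu> \<eta> = 0"
      using w b discr_factor[of \<mu> \<eta>] by auto
    moreover have "offset \<kappa>\<^sub>2 \<mu> \<eta> < 0" "0 < offset \<kappa>\<^sub>1 \<mu> \<eta>"
      using offset_signs[OF assms(1) k2 b(1,2)] w b by auto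
    ultimately show "pseudo_saddle_node \<kappa>\<^sub>1 \<kappa>\<^sub>2 \<mu> \<eta> z"
      using x seg saddle_node_iff[of \<kappa>\<^sub>1 \<kappa>\<^sub>2 \<eta> \<mu> x] assms(2) xy
      by (auto simp: pseudo_saddle_node_def z mult_less_0_iff)
  qed
qed

lemma switches_acrossI:
  assumes "open U" "w \<in> U"
    and "\<And>m e. (m, e) \<in> U \<Longrightarrow> c m < e \<Longrightarrow> P m e" "\<And>m e. (m, e) \<in> U \<Longrightarrow> e < c m \<Longrightarrow> Q m e"
  shows "switches_across c P Q w"
proof -
  obtain \<epsilon> where "\<epsilon> > 0" "ball w \<epsilon> \<subseteq> U"
    using assms(1,2) open_contains_ball by blast
  then show ?thesis
    unfolding switches_across_def using assms(3,4) by blast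
qed

text \<open>Near a point of PS, parameters above the curve are in region VII, and below it the
  discriminant is negative.\<close>

lemma pseudo_saddle_node_unfolding:
  assumes "0 < \<kappa>\<^sub>1" "\<kappa>\<^sub>1 < \<kappa>\<^sub>2" "(\<mu>, \<eta>) \<in> PS \<kappa>\<^sub>1 \<kappa>\<^sub>2"
  shows "switches_across ps_curve
           (\<lambda>m e. q_minus m e \<noteq> q_plus m e \<and>
                  admissible_pseudo \<kappa>\<^sub>1 \<kappa>\<^sub>2 m e (q_minus m e) \<and>
                  admissible_pseudo \<kappa>\<^sub>1 \<kappa>\<^sub>2 m e (q_plus m e))
           (\<lambda>m e. \<not> (\<exists>z. pseudo_equilibrium \<kappa>\<^sub>1 \<kappa>\<^sub>2 m e z))
           (\<mu>, \<eta>)"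
proof -
  have k2: "0 < \<kappa>\<^sub>2" using assms by simp
  \<comment> \<open>The last condition excludes the lower zero branch of the discriminant; on
    \<open>U\<close> its sign is therefore that of \<open>\<eta> - ps_curve \<mu>\<close>.\<close>
  define U where "U = {w :: real \<times> real. \<kappa>\<^sub>1\<^sup>2 / (\<kappa>\<^sub>1 + 1)\<^sup>2 < fst w \<and> fst w < \<kappa>\<^sub>2\<^sup>2 / (\<kappa>\<^sub>2 + 1)\<^sup>2 \<and>
    snd w < be_line \<kappa>\<^sub>1 (fst w) \<and> snd w < be_line \<kappa>\<^sub>2 (fst w) \<and> - (1 + sqrt (fst w))\<^sup>2 < snd w}"
  show ?thesis
  proof (rule switches_acrossI)
    have "\<kappa>\<^sub>1 \<noteq> 0" "\<kappa>\<^sub>2 \<noteq> 0" using assms by auto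
    then show "open U"
      unfolding U_def be_line_def
      by (intro open_Collect_conj open_Collect_less continuous_intros) auto
    have b: "\<kappa>\<^sub>1\<^sup>2 / (\<kappa>\<^sub>1 + 1)\<^sup>2 < \<mu>" "\<mu> < \<kappa>\<^sub>2\<^sup>2 / (\<kappa>\<^sub>2 + 1)\<^sup>2" "\<eta> = ps_curve \<mu>"
      using assms(3) by (auto simp: PS_def)
    note w = window_bounds[OF assms(1) k2 b(1,2)]
    have "- (1 + sqrt \<mu>)\<^sup>2 < ps_curve \<mu>"
      using w(1) by (simp add: ps_curve_def power2_sum)
    then show "(\<mu>, \<eta>) \<in> U"
      using w b by (simp add: U_def)
  next
    fix m e assume U: "(m, e) \<in> U" and "ps_curve m < e"
    then have "(m, e) \<in> region_VII \<kappa>\<^sub>1 \<kappa>\<^sub>2"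
      by (simp add: region_VII_def U_def)
    note adm = region_VII_admissible[OF assms(1,2) this]
    then have "sqrt ((e + m + 1)\<^sup>2 - 4 * m) > 0"
      by (simp add: discr_def)
    then have "q_minus m e \<noteq> q_plus m e"
      by (auto simp: q_minus_def q_plus_def)
    then show "q_minus m e \<noteq> q_plus m e \<and>
        admissible_pseudo \<kappa>\<^sub>1 \<kappa>\<^sub>2 m e (q_minus m e) \<and> admissible_pseudo \<kappa>\<^sub>1 \<kappa>\<^sub>2 m e (q_plus m e)"
      using adm by blast
  next
    fix m e assume U: "(m, e) \<in> U" and e: "e < ps_curve m"
    then have b: "\<kappa>\<^sub>1\<^sup>2 / (\<kappa>\<^sub>1 + 1)\<^sup>2 < m" "m < \<kappa>\<^sub>2\<^sup>2 / (\<kappa>\<^sub>2 + 1)\<^sup>2" "- (1 + sqrt m)\<^sup>2 < e"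
      by (simp_all add: U_def)
    note w = window_bounds[OF assms(1) k2 b(1,2)]
    have "discr m e < 0"
      using discr_factor[of m e] w(1) e b(3) by (simp add: mult_less_0_iff)
    moreover have "e \<noteq> 0" using w e by linarith
    ultimately show "\<not> (\<exists>z. pseudo_equilibrium \<kappa>\<^sub>1 \<kappa>\<^sub>2 m e z)"
      using pseudo_equilibrium_iff[of \<kappa>\<^sub>1 \<kappa>\<^sub>2 e m] assms(2) by (simp add: discr_def)
  qed
qed

lemma pseudo_equilibria_on_PS:
  assumes "0 < \<kappa>\<^sub>1" "\<kappa>\<^sub>1 < \<kappa>\<^sub>2" "(\<mu>, \<eta>) \<in> PS \<kappa>\<^sub>1 \<kappa>\<^sub>2"
  shows "\<eta> < 0" "q_minus \<mu> \<eta> = (1 - sqrt \<mu>) *\<^sub>R (1, 1) + (0, \<eta>)"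
    "q_plus \<mu> \<eta> = (1 - sqrt \<mu>) *\<^sub>R (1, 1) + (0, \<eta>)"
proof -
  have k2: "0 < \<kappa>\<^sub>2" using assms by simp
  have b: "\<kappa>\<^sub>1\<^sup>2 / (\<kappa>\<^sub>1 + 1)\<^sup>2 < \<mu>" "\<mu> < \<kappa>\<^sub>2\<^sup>2 / (\<kappa>\<^sub>2 + 1)\<^sup>2" "\<eta> = ps_curve \<mu>"
    using assms(3) by (auto simp: PS_def)
  note w = window_bounds[OF assms(1) k2 b(1,2)]
  show "\<eta> < 0" using w b by simp
  have "discr \<mu> \<eta> = 0"
    using discr_factor[of \<mu> \<eta>] b w by simp
  then show "q_minus \<mu> \<eta> = (1 - sqrt \<mu>) *\<^sub>R (1, 1) + (0, \<eta>)"
    "q_plus \<mu> \<eta> = (1 - sqrt \<mu>) *\<^sub>R (1, 1) + (0, \<eta>)"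
    by (simp_all add: q_minus_def q_plus_def discr_def b(3) ps_curve_def field_simps)
qed

section \<open>Boundary equilibria\<close>

lemma boundary_equilibrium_bifurcation_iff:
  "boundary_equilibrium_bifurcation \<kappa> \<mu> \<eta> \<longleftrightarrow> (\<mu>, \<eta>) \<in> BE \<kappa>"
  by (auto simp: boundary_equilibrium_bifurcation_def BE_def equilibrium_def
      switching_manifold_def be_line_def)

text \<open>On BE the multiplier in \<open>vf_tangency_point\<close> is zero, and the equilibrium is
  the only zero of the field.\<close>

lemma equilibrium_eq_tangency_point:
  assumes "\<kappa> > 0" "(\<mu>, \<eta>) \<in> BE \<kappa>"
  shows "equilibrium \<kappa> \<mu> = tangency_point \<kappa> \<mu> \<eta>"
  using assms equilibrium_iff[OF assms(1), of \<mu> "tangency_point \<kappa> \<mu> \<eta>"]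
    vf_tangency_point[OF assms(1), of \<mu> \<eta>]
  by (simp add: BE_def zero_prod_def)

lemma
  assumes "\<kappa> > 0"
  shows F1_visible_iff: "F1_visible \<kappa> \<mu> \<eta> \<longleftrightarrow> be_line \<kappa> \<mu> < \<eta>"
    and F1_invisible_iff: "F1_invisible \<kappa> \<mu> \<eta> \<longleftrightarrow> \<eta> < be_line \<kappa> \<mu>"
    and F2_visible_iff: "F2_visible \<kappa> \<mu> \<eta> \<longleftrightarrow> \<eta> < be_line \<kappa> \<mu>"
    and F2_invisible_iff: "F2_invisible \<kappa> \<mu> \<eta> \<longleftrightarrow> be_line \<kappa> \<mu> < \<eta>"
  unfolding F1_visible_def F1_invisible_def F2_visible_def F2_invisible_def invisible_tangency_def
    visible_tangency_iff[OF assms] quadratic_tangency_iff[OF assms] by auto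

text \<open>The visibility criteria hold in the whole parameter plane, so any neighbourhood will
  do.\<close>

lemma switches_across_BE:
  assumes "\<kappa> > 0"
  shows "switches_across (be_line \<kappa>) (F1_visible \<kappa>) (F1_invisible \<kappa>) w"
    and "switches_across (be_line \<kappa>) (F2_invisible \<kappa>) (F2_visible \<kappa>) w"
  by (rule switches_acrossI[of UNIV];
      simp add: F1_visible_iff F1_invisible_iff F2_visible_iff F2_invisible_iff assms)+

section \<open>Fold-fold bifurcations\<close>

lemma switches_across_FF:
  assumes "\<kappa>\<^sub>1 < \<kappa>\<^sub>2"
  shows "switches_across (\<lambda>_. 0)
           (\<lambda>m e. fst (tangency_point \<kappa>\<^sub>1 m e) < fst (tangency_point \<kappa>\<^sub>2 m e) \<and>
                  sliding_segment \<kappa>\<^sub>1 \<kappa>\<^sub>2 m e \<noteq> {} \<and>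
                  sliding_segment \<kappa>\<^sub>1 \<kappa>\<^sub>2 m e = attracting_sliding \<kappa>\<^sub>1 \<kappa>\<^sub>2 m e)
           (\<lambda>m e. fst (tangency_point \<kappa>\<^sub>2 m e) < fst (tangency_point \<kappa>\<^sub>1 m e) \<and>
                  sliding_segment \<kappa>\<^sub>1 \<kappa>\<^sub>2 m e \<noteq> {} \<and>
                  sliding_segment \<kappa>\<^sub>1 \<kappa>\<^sub>2 m e = repelling_sliding \<kappa>\<^sub>1 \<kappa>\<^sub>2 m e)
           w"
proof (rule switches_acrossI[of UNIV])
  have ne: "sliding_segment \<kappa>\<^sub>1 \<kappa>\<^sub>2 m e \<noteq> {}" if "e \<noteq> 0" for m e
    using that assms tangency_points_coincide_iff[of \<kappa>\<^sub>1 \<kappa>\<^sub>2 m e]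
    by (simp add: sliding_segment_eq_open_segment)
  show "fst (tangency_point \<kappa>\<^sub>1 m e) < fst (tangency_point \<kappa>\<^sub>2 m e) \<and>
      sliding_segment \<kappa>\<^sub>1 \<kappa>\<^sub>2 m e \<noteq> {} \<and>
      sliding_segment \<kappa>\<^sub>1 \<kappa>\<^sub>2 m e = attracting_sliding \<kappa>\<^sub>1 \<kappa>\<^sub>2 m e" if "0 < e" for m e
    using that assms ne[of e m] attracting_sliding_segment by (simp add: tangency_point_def)
  show "fst (tangency_point \<kappa>\<^sub>2 m e) < fst (tangency_point \<kappa>\<^sub>1 m e) \<and>
      sliding_segment \<kappa>\<^sub>1 \<kappa>\<^sub>2 m e \<noteq> {} \<and>
      sliding_segment \<kappa>\<^sub>1 \<kappa>\<^sub>2 m e = repelling_sliding \<kappa>\<^sub>1 \<kappa>\<^sub>2 m e" if "e < 0" for m e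
    using that assms ne[of e m] repelling_sliding_segment by (simp add: tangency_point_def)
qed simp_all

section \<open>The bifurcation diagram\<close>

text \<open>Each of the eight regions has a verdict on every property, so on their union the
  implications proved region by region become equivalences.\<close>

lemma regions_diagram:
  assumes "0 < \<kappa>\<^sub>1" "\<kappa>\<^sub>1 < \<kappa>\<^sub>2" "(\<mu>, \<eta>) \<in> all_regions \<kappa>\<^sub>1 \<kappa>\<^sub>2"
  shows "be_line \<kappa>\<^sub>1 \<mu> < \<eta> \<longleftrightarrow>
      (\<mu>, \<eta>) \<in> region_I \<kappa>\<^sub>1 \<kappa>\<^sub>2 \<union> region_IV \<kappa>\<^sub>1 \<kappa>\<^sub>2 \<union> region_VIII \<kappa>\<^sub>1 \<kappa>\<^sub>2"
    and "\<eta> < be_line \<kappa>\<^sub>2 \<mu> \<longleftrightarrow>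
      (\<mu>, \<eta>) \<in> region_III \<kappa>\<^sub>1 \<kappa>\<^sub>2 \<union> region_VI \<kappa>\<^sub>1 \<kappa>\<^sub>2 \<union> region_VII \<kappa>\<^sub>1 \<kappa>\<^sub>2 \<union> region_VIII \<kappa>\<^sub>1 \<kappa>\<^sub>2"
    and "admissible_pseudo \<kappa>\<^sub>1 \<kappa>\<^sub>2 \<mu> \<eta> (q_plus \<mu> \<eta>) \<longleftrightarrow>
      (\<mu>, \<eta>) \<in> region_II \<kappa>\<^sub>1 \<kappa>\<^sub>2 \<union> region_V \<kappa>\<^sub>1 \<kappa>\<^sub>2 \<union> region_VII \<kappa>\<^sub>1 \<kappa>\<^sub>2"
    and "admissible_pseudo \<kappa>\<^sub>1 \<kappa>\<^sub>2 \<mu> \<eta> (q_minus \<mu> \<eta>) \<longleftrightarrow>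
      (\<mu>, \<eta>) \<in> region_VII \<kappa>\<^sub>1 \<kappa>\<^sub>2 \<union> region_VIII \<kappa>\<^sub>1 \<kappa>\<^sub>2"
proof -
  let ?w = "(\<mu>, \<eta>)"
  show "be_line \<kappa>\<^sub>1 \<mu> < \<eta> \<longleftrightarrow>
      ?w \<in> region_I \<kappa>\<^sub>1 \<kappa>\<^sub>2 \<union> region_IV \<kappa>\<^sub>1 \<kappa>\<^sub>2 \<union> region_VIII \<kappa>\<^sub>1 \<kappa>\<^sub>2"
    using assms(3)
    by (auto simp: all_regions_def region_I_def region_II_def region_III_def region_IV_def
        region_V_def region_VI_def region_VII_def region_VIII_def)
  show "\<eta> < be_line \<kappa>\<^sub>2 \<mu> \<longleftrightarrow>
      ?w \<in> region_III \<kappa>\<^sub>1 \<kappa>\<^sub>2 \<union> region_VI \<kappa>\<^sub>1 \<kappa>\<^sub>2 \<union> region_VII \<kappa>\<^sub>1 \<kappa>\<^sub>2 \<union> region_VIII \<kappa>\<^sub>1 \<kappa>\<^sub>2"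
    using assms(3)
    by (auto simp: all_regions_def region_I_def region_II_def region_III_def region_IV_def
        region_V_def region_VI_def region_VII_def region_VIII_def)
  have adm: "admissible_pseudo \<kappa>\<^sub>1 \<kappa>\<^sub>2 \<mu> \<eta> (q_plus \<mu> \<eta>)"
    "\<not> admissible_pseudo \<kappa>\<^sub>1 \<kappa>\<^sub>2 \<mu> \<eta> (q_minus \<mu> \<eta>)"
    if "?w \<in> region_II \<kappa>\<^sub>1 \<kappa>\<^sub>2 \<union> region_V \<kappa>\<^sub>1 \<kappa>\<^sub>2"
    using that opposite_sides_admissible[OF assms(1,2)]
    by (auto simp: region_II_def region_V_def)
  note cases = adm region_VII_admissible(3,4)[OF assms(1,2)] region_VIII_admissible[OF assms(1,2)]
    region_VI_not_admissible[OF assms(1,2)] not_admissible[OF assms(1,2)]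
  show "admissible_pseudo \<kappa>\<^sub>1 \<kappa>\<^sub>2 \<mu> \<eta> (q_plus \<mu> \<eta>) \<longleftrightarrow>
      ?w \<in> region_II \<kappa>\<^sub>1 \<kappa>\<^sub>2 \<union> region_V \<kappa>\<^sub>1 \<kappa>\<^sub>2 \<union> region_VII \<kappa>\<^sub>1 \<kappa>\<^sub>2"
    using assms(3) cases unfolding all_regions_def by blast
  show "admissible_pseudo \<kappa>\<^sub>1 \<kappa>\<^sub>2 \<mu> \<eta> (q_minus \<mu> \<eta>) \<longleftrightarrow>
      ?w \<in> region_VII \<kappa>\<^sub>1 \<kappa>\<^sub>2 \<union> region_VIII \<kappa>\<^sub>1 \<kappa>\<^sub>2"
    using assms(3) cases unfolding all_regions_def by blast
qed

theorem proposition3: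
  fixes \<kappa>\<^sub>1 \<kappa>\<^sub>2 :: real
  assumes "0 < \<kappa>\<^sub>1" and "\<kappa>\<^sub>1 < \<kappa>\<^sub>2"
  shows
    "({(\<mu>, \<eta>). boundary_equilibrium_bifurcation \<kappa>\<^sub>1 \<mu> \<eta>} = BE \<kappa>\<^sub>1 \<and>
      {(\<mu>, \<eta>). boundary_equilibrium_bifurcation \<kappa>\<^sub>2 \<mu> \<eta>} = BE \<kappa>\<^sub>2 \<and>
      (\<forall>(\<mu>, \<eta>) \<in> BE \<kappa>\<^sub>1.
         equilibrium \<kappa>\<^sub>1 \<mu> = tangency_point \<kappa>\<^sub>1 \<mu> \<eta> \<and>
         switches_across (be_line \<kappa>\<^sub>1) (F1_visible \<kappa>\<^sub>1) (F1_invisible \<kappa>\<^sub>1) (\<mu>, \<eta>)) \<and>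
      (\<forall>(\<mu>, \<eta>) \<in> BE \<kappa>\<^sub>2.
         equilibrium \<kappa>\<^sub>2 \<mu> = tangency_point \<kappa>\<^sub>2 \<mu> \<eta> \<and>
         switches_across (be_line \<kappa>\<^sub>2) (F2_invisible \<kappa>\<^sub>2) (F2_visible \<kappa>\<^sub>2) (\<mu>, \<eta>)) \<and>
      (\<forall>(\<mu>, \<eta>) \<in> all_regions \<kappa>\<^sub>1 \<kappa>\<^sub>2.
         (F1_visible \<kappa>\<^sub>1 \<mu> \<eta> \<longleftrightarrow>
            (\<mu>, \<eta>) \<in> region_I \<kappa>\<^sub>1 \<kappa>\<^sub>2 \<union> region_IV \<kappa>\<^sub>1 \<kappa>\<^sub>2 \<union> region_VIII \<kappa>\<^sub>1 \<kappa>\<^sub>2) \<and>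
         (F2_visible \<kappa>\<^sub>2 \<mu> \<eta> \<longleftrightarrow>
            (\<mu>, \<eta>) \<in> region_III \<kappa>\<^sub>1 \<kappa>\<^sub>2 \<union> region_VI \<kappa>\<^sub>1 \<kappa>\<^sub>2 \<union> region_VII \<kappa>\<^sub>1 \<kappa>\<^sub>2 \<union>
                      region_VIII \<kappa>\<^sub>1 \<kappa>\<^sub>2) \<and>
         (admissible_pseudo \<kappa>\<^sub>1 \<kappa>\<^sub>2 \<mu> \<eta> (q_plus \<mu> \<eta>) \<longleftrightarrow>
            (\<mu>, \<eta>) \<in> region_II \<kappa>\<^sub>1 \<kappa>\<^sub>2 \<union> region_V \<kappa>\<^sub>1 \<kappa>\<^sub>2 \<union> region_VII \<kappa>\<^sub>1 \<kappa>\<^sub>2) \<and>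
         (admissible_pseudo \<kappa>\<^sub>1 \<kappa>\<^sub>2 \<mu> \<eta> (q_minus \<mu> \<eta>) \<longleftrightarrow>
            (\<mu>, \<eta>) \<in> region_VII \<kappa>\<^sub>1 \<kappa>\<^sub>2 \<union> region_VIII \<kappa>\<^sub>1 \<kappa>\<^sub>2)))
     \<and>
     ({(\<mu>, \<eta>). fold_fold_bifurcation \<kappa>\<^sub>1 \<kappa>\<^sub>2 \<mu> \<eta>} = FF \<and>
      (\<forall>\<mu> \<eta>. sliding_segment \<kappa>\<^sub>1 \<kappa>\<^sub>2 \<mu> \<eta> =
               open_segment (tangency_point \<kappa>\<^sub>1 \<mu> \<eta>) (tangency_point \<kappa>\<^sub>2 \<mu> \<eta>)) \<and>
      (\<forall>(\<mu>, \<eta>) \<in> FF.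
         (\<exists>z. tangency_point \<kappa>\<^sub>1 \<mu> \<eta> = z \<and> tangency_point \<kappa>\<^sub>2 \<mu> \<eta> = z \<and>
              singular_tangency \<kappa>\<^sub>1 \<kappa>\<^sub>2 \<mu> \<eta> z) \<and>
         switches_across (\<lambda>_. 0)
           (\<lambda>m e. fst (tangency_point \<kappa>\<^sub>1 m e) < fst (tangency_point \<kappa>\<^sub>2 m e) \<and>
                  sliding_segment \<kappa>\<^sub>1 \<kappa>\<^sub>2 m e \<noteq> {} \<and>
                  sliding_segment \<kappa>\<^sub>1 \<kappa>\<^sub>2 m e = attracting_sliding \<kappa>\<^sub>1 \<kappa>\<^sub>2 m e)
           (\<lambda>m e. fst (tangency_point \<kappa>\<^sub>2 m e) < fst (tangency_point \<kappa>\<^sub>1 m e) \<and>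
                  sliding_segment \<kappa>\<^sub>1 \<kappa>\<^sub>2 m e \<noteq> {} \<and>
                  sliding_segment \<kappa>\<^sub>1 \<kappa>\<^sub>2 m e = repelling_sliding \<kappa>\<^sub>1 \<kappa>\<^sub>2 m e)
           (\<mu>, \<eta>)))
     \<and>
     ({(\<mu>, \<eta>). \<exists>z. pseudo_saddle_node \<kappa>\<^sub>1 \<kappa>\<^sub>2 \<mu> \<eta> z} = PS \<kappa>\<^sub>1 \<kappa>\<^sub>2 \<and>
      (\<forall>(\<mu>, \<eta>) \<in> PS \<kappa>\<^sub>1 \<kappa>\<^sub>2.
         (let q = (1 - sqrt \<mu>) *\<^sub>R (1, 1) + (0, \<eta>)
          in q_minus \<mu> \<eta> = q \<and> q_plus \<mu> \<eta> = q \<and>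
             pseudo_saddle_node \<kappa>\<^sub>1 \<kappa>\<^sub>2 \<mu> \<eta> q \<and>
             q \<in> repelling_sliding \<kappa>\<^sub>1 \<kappa>\<^sub>2 \<mu> \<eta>) \<and>
         switches_across ps_curve
           (\<lambda>m e. q_minus m e \<noteq> q_plus m e \<and>
                  admissible_pseudo \<kappa>\<^sub>1 \<kappa>\<^sub>2 m e (q_minus m e) \<and>
                  admissible_pseudo \<kappa>\<^sub>1 \<kappa>\<^sub>2 m e (q_plus m e))
           (\<lambda>m e. \<not> (\<exists>z. pseudo_equilibrium \<kappa>\<^sub>1 \<kappa>\<^sub>2 m e z))
           (\<mu>, \<eta>)))"
proof (intro conjI)
  have k2: "0 < \<kappa>\<^sub>2" using assms by simp
  show "{(\<mu>, \<eta>). boundary_equilibrium_bifurcation \<kappa>\<^sub>1 \<mu> \<eta>} = BE \<kappa>\<^sub>1"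
    "{(\<mu>, \<eta>). boundary_equilibrium_bifurcation \<kappa>\<^sub>2 \<mu> \<eta>} = BE \<kappa>\<^sub>2"
    by (auto simp: boundary_equilibrium_bifurcation_iff)
  show "\<forall>(\<mu>, \<eta>) \<in> BE \<kappa>\<^sub>1. equilibrium \<kappa>\<^sub>1 \<mu> = tangency_point \<kappa>\<^sub>1 \<mu> \<eta> \<and>
      switches_across (be_line \<kappa>\<^sub>1) (F1_visible \<kappa>\<^sub>1) (F1_invisible \<kappa>\<^sub>1) (\<mu>, \<eta>)"
    using equilibrium_eq_tangency_point switches_across_BE(1) assms(1) by blast
  show "\<forall>(\<mu>, \<eta>) \<in> BE \<kappa>\<^sub>2. equilibrium \<kappa>\<^sub>2 \<mu> = tangency_point \<kappa>\<^sub>2 \<mu> \<eta> \<and>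
      switches_across (be_line \<kappa>\<^sub>2) (F2_invisible \<kappa>\<^sub>2) (F2_visible \<kappa>\<^sub>2) (\<mu>, \<eta>)"
    using equilibrium_eq_tangency_point switches_across_BE(2) k2 by blast
  show "\<forall>(\<mu>, \<eta>) \<in> all_regions \<kappa>\<^sub>1 \<kappa>\<^sub>2.
         (F1_visible \<kappa>\<^sub>1 \<mu> \<eta> \<longleftrightarrow>
            (\<mu>, \<eta>) \<in> region_I \<kappa>\<^sub>1 \<kappa>\<^sub>2 \<union> region_IV \<kappa>\<^sub>1 \<kappa>\<^sub>2 \<union> region_VIII \<kappa>\<^sub>1 \<kappa>\<^sub>2) \<and>
         (F2_visible \<kappa>\<^sub>2 \<mu> \<eta> \<longleftrightarrow>
            (\<mu>, \<eta>) \<in> region_III \<kappa>\<^sub>1 \<kappa>\<^sub>2 \<union> region_VI \<kappa>\<^sub>1 \<kappa>\<^sub>2 \<union> region_VII \<kappa>\<^sub>1 \<kappa>\<^sub>2 \<union>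
                      region_VIII \<kappa>\<^sub>1 \<kappa>\<^sub>2) \<and>
         (admissible_pseudo \<kappa>\<^sub>1 \<kappa>\<^sub>2 \<mu> \<eta> (q_plus \<mu> \<eta>) \<longleftrightarrow>
            (\<mu>, \<eta>) \<in> region_II \<kappa>\<^sub>1 \<kappa>\<^sub>2 \<union> region_V \<kappa>\<^sub>1 \<kappa>\<^sub>2 \<union> region_VII \<kappa>\<^sub>1 \<kappa>\<^sub>2) \<and>
         (admissible_pseudo \<kappa>\<^sub>1 \<kappa>\<^sub>2 \<mu> \<eta> (q_minus \<mu> \<eta>) \<longleftrightarrow>
            (\<mu>, \<eta>) \<in> region_VII \<kappa>\<^sub>1 \<kappa>\<^sub>2 \<union> region_VIII \<kappa>\<^sub>1 \<kappa>\<^sub>2)"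
    unfolding F1_visible_iff[OF assms(1)] F2_visible_iff[OF k2]
    using regions_diagram[OF assms] by blast
  show "{(\<mu>, \<eta>). fold_fold_bifurcation \<kappa>\<^sub>1 \<kappa>\<^sub>2 \<mu> \<eta>} = FF"
    using assms(2) by (simp add: fold_fold_bifurcation_def FF_def tangency_points_coincide_iff)
  show "\<forall>\<mu> \<eta>. sliding_segment \<kappa>\<^sub>1 \<kappa>\<^sub>2 \<mu> \<eta> =
      open_segment (tangency_point \<kappa>\<^sub>1 \<mu> \<eta>) (tangency_point \<kappa>\<^sub>2 \<mu> \<eta>)"
    using sliding_segment_eq_open_segment by blast
  have "singular_tangency \<kappa>\<^sub>1 \<kappa>\<^sub>2 \<mu> \<eta> (tangency_point \<kappa>\<^sub>1 \<mu> \<eta>)"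
    "tangency_point \<kappa>\<^sub>1 \<mu> \<eta> = tangency_point \<kappa>\<^sub>2 \<mu> \<eta>" if "(\<mu>, \<eta>) \<in> FF" for \<mu> \<eta>
  proof -
    show eq: "tangency_point \<kappa>\<^sub>1 \<mu> \<eta> = tangency_point \<kappa>\<^sub>2 \<mu> \<eta>"
      using that assms(2) by (simp add: FF_def tangency_points_coincide_iff)
    then show "singular_tangency \<kappa>\<^sub>1 \<kappa>\<^sub>2 \<mu> \<eta> (tangency_point \<kappa>\<^sub>1 \<mu> \<eta>)"
      unfolding singular_tangency_def using tangency_point_iff by blast
  qed
  then show "\<forall>(\<mu>, \<eta>) \<in> FF.
         (\<exists>z. tangency_point \<kappa>\<^sub>1 \<mu> \<eta> = z \<and> tangency_point \<kappa>\<^sub>2 \<mu> \<eta> = z \<and>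
              singular_tangency \<kappa>\<^sub>1 \<kappa>\<^sub>2 \<mu> \<eta> z) \<and>
         switches_across (\<lambda>_. 0)
           (\<lambda>m e. fst (tangency_point \<kappa>\<^sub>1 m e) < fst (tangency_point \<kappa>\<^sub>2 m e) \<and>
                  sliding_segment \<kappa>\<^sub>1 \<kappa>\<^sub>2 m e \<noteq> {} \<and>
                  sliding_segment \<kappa>\<^sub>1 \<kappa>\<^sub>2 m e = attracting_sliding \<kappa>\<^sub>1 \<kappa>\<^sub>2 m e)
           (\<lambda>m e. fst (tangency_point \<kappa>\<^sub>2 m e) < fst (tangency_point \<kappa>\<^sub>1 m e) \<and>
                  sliding_segment \<kappa>\<^sub>1 \<kappa>\<^sub>2 m e \<noteq> {} \<and>
                  sliding_segment \<kappa>\<^sub>1 \<kappa>\<^sub>2 m e = repelling_sliding \<kappa>\<^sub>1 \<kappa>\<^sub>2 m e)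
           (\<mu>, \<eta>)"
    using switches_across_FF[OF assms(2)] by auto
  show "{(\<mu>, \<eta>). \<exists>z. pseudo_saddle_node \<kappa>\<^sub>1 \<kappa>\<^sub>2 \<mu> \<eta> z} = PS \<kappa>\<^sub>1 \<kappa>\<^sub>2"
    by (auto simp: pseudo_saddle_node_iff[OF assms])
  have "q_minus \<mu> \<eta> = q \<and> q_plus \<mu> \<eta> = q \<and> pseudo_saddle_node \<kappa>\<^sub>1 \<kappa>\<^sub>2 \<mu> \<eta> q \<and>
      q \<in> repelling_sliding \<kappa>\<^sub>1 \<kappa>\<^sub>2 \<mu> \<eta>"
    if "(\<mu>, \<eta>) \<in> PS \<kappa>\<^sub>1 \<kappa>\<^sub>2" "q = (1 - sqrt \<mu>) *\<^sub>R (1, 1) + (0, \<eta>)" for \<mu> \<eta> q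
  proof -
    have sn: "pseudo_saddle_node \<kappa>\<^sub>1 \<kappa>\<^sub>2 \<mu> \<eta> q"
      using that pseudo_saddle_node_iff[OF assms] by blast
    \<comment> \<open>A pseudo-saddle-node lies on the sliding segment by definition, and for
      \<open>\<eta> < 0\<close> the whole segment is repelling.\<close>
    then have "q \<in> repelling_sliding \<kappa>\<^sub>1 \<kappa>\<^sub>2 \<mu> \<eta>"
      using repelling_sliding_segment[OF assms(2)] pseudo_equilibria_on_PS(1)[OF assms that(1)]
      unfolding pseudo_saddle_node_def by blast
    then show ?thesis
      using sn pseudo_equilibria_on_PS(2,3)[OF assms that(1)] that(2) by blast
  qed
  then show "\<forall>(\<mu>, \<eta>) \<in> PS \<kappa>\<^sub>1 \<kappa>\<^sub>2.
         (let q = (1 - sqrt \<mu>) *\<^sub>R (1, 1) + (0, \<eta>)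
          in q_minus \<mu> \<eta> = q \<and> q_plus \<mu> \<eta> = q \<and>
             pseudo_saddle_node \<kappa>\<^sub>1 \<kappa>\<^sub>2 \<mu> \<eta> q \<and>
             q \<in> repelling_sliding \<kappa>\<^sub>1 \<kappa>\<^sub>2 \<mu> \<eta>) \<and>
         switches_across ps_curve
           (\<lambda>m e. q_minus m e \<noteq> q_plus m e \<and>
                  admissible_pseudo \<kappa>\<^sub>1 \<kappa>\<^sub>2 m e (q_minus m e) \<and>
                  admissible_pseudo \<kappa>\<^sub>1 \<kappa>\<^sub>2 m e (q_plus m e))
           (\<lambda>m e. \<not> (\<exists>z. pseudo_equilibrium \<kappa>\<^sub>1 \<kappa>\<^sub>2 m e z))
           (\<mu>, \<eta>)"
    using pseudo_saddle_node_unfolding[OF assms] by (auto simp: Let_def)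
qed

end
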